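(* Let $s\ge 2$ and $p\ge 2$ be fixed integers. The number of pairwise non-isomorphic graphs in $\mathcal{G}(s,p)$ is $\frac{a(p)(a(p)+1)}{2}$, where $a(p)$ is the number of partitions of the integer $p$.
   Context: All graphs are finite, simple and connected. A vertex is simplicial if its neighbourhood is a clique. A minimal vertex separator is a set $S$ that, for some non-adjacent vertices $u,v$, separates $u$ and $v$ into different components of $G-S$ and is inclusion-minimal with this property. A graph is strictly chordal if it is obtained from a block graph (connected graph all of whose blocks are cliques) by adding zero or more true twins ($N[u]=N[v]$) to each vertex; a strictly interval graph is a graph that is both strictly chordal and an interval graph. For integers $s,p\ge 2$, $\mathcal{G}(s,p)$ is the set of $SI$-core graphs with parameters $s,p$: strictly interval graphs $G$ with exactly two minimal vertex separators $S_1,S_2$, such that $|S_1|=|S_2|=s$, $S_1\cup S_2$ is a maximal clique of $G$ (of size $2s$), and each $S_i$ has exactly $p$ simplicial vertices adjacent to it. Explicitly, $V(G)=S_1\cup S_2\cup P_1\cup P_2$ (disjoint), $|P_i|=p$, $P_i$ being the simplicial vertices adjacent to $S_i$; every vertex of $P_i$ is adjacent to all of $S_i$ and to no vertex of $S_{3-i}\cup P_{3-i}$, and $G[P_i]$ is a disjoint union of complete graphs. *)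

theory Defs
  imports Complex_Main "HOL-Library.Multiset"
    "Graph_Theory.Digraph_Component" "Graph_Theory.Digraph_Isomorphism"
begin

text \<open>
  As in \<^theory>\<open>Graph_Theory.Digraph\<close>, a finite simple graph is a finite symmetric digraph without
  loops and multiple arcs (locale \<^locale>\<open>graph\<close>). Since the arcs are symmetric, two vertices are
  adjacent iff one dominates the other, and they lie in the same component iff one is reachable
  from the other.
\<close>

text \<open>The topological constant of the same name would otherwise be ambiguous.\<close>

abbreviation graph_connected :: "('a,'b) pre_digraph \<Rightarrow> bool" where
  "graph_connected \<equiv> Digraph_Component.connected"

definition nbhd :: "('a,'b) pre_digraph \<Rightarrow> 'a \<Rightarrow> 'a set" where
  "nbhd G v = {u. v \<rightarrow>\<^bsub>G\<^esub> u}"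

definition closed_nbhd :: "('a,'b) pre_digraph \<Rightarrow> 'a \<Rightarrow> 'a set" where
  "closed_nbhd G v = insert v (nbhd G v)"

definition clique :: "('a,'b) pre_digraph \<Rightarrow> 'a set \<Rightarrow> bool" where
  "clique G K \<longleftrightarrow> K \<subseteq> verts G \<and> (\<forall>u\<in>K. \<forall>v\<in>K. u \<noteq> v \<longrightarrow> u \<rightarrow>\<^bsub>G\<^esub> v)"

definition maximal_clique :: "('a,'b) pre_digraph \<Rightarrow> 'a set \<Rightarrow> bool" where
  "maximal_clique G K \<longleftrightarrow> clique G K \<and> (\<forall>K'. clique G K' \<and> K \<subseteq> K' \<longrightarrow> K' = K)"

definition simplicial :: "('a,'b) pre_digraph \<Rightarrow> 'a \<Rightarrow> bool" where
  "simplicial G v \<longleftrightarrow> v \<in> verts G \<and> clique G (nbhd G v)"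

definition separates :: "('a,'b) pre_digraph \<Rightarrow> 'a set \<Rightarrow> 'a \<Rightarrow> 'a \<Rightarrow> bool" where
  "separates G S u v \<longleftrightarrow> S \<subseteq> verts G \<and> u \<in> verts G - S \<and> v \<in> verts G - S \<and>
     \<not> u \<rightarrow>\<^sup>*\<^bsub>G \<restriction> (verts G - S)\<^esub> v"

text \<open>Minimality is with respect to the fixed pair \<open>u\<close>, \<open>v\<close>; a minimal vertex separator may
  properly contain another one that separates a different pair.\<close>

definition minimal_vertex_separator :: "('a,'b) pre_digraph \<Rightarrow> 'a set \<Rightarrow> bool" where
  "minimal_vertex_separator G S \<longleftrightarrow>
     (\<exists>u\<in>verts G. \<exists>v\<in>verts G. u \<noteq> v \<and> \<not> u \<rightarrow>\<^bsub>G\<^esub> v \<and>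
        separates G S u v \<and> (\<forall>T. T \<subset> S \<longrightarrow> \<not> separates G T u v))"

text \<open>Only meant for connected \<open>G\<close>. The vertex of a one-vertex graph is not a cut vertex; it is
  excluded explicitly because the empty graph does not count as connected.\<close>

definition cut_vertex :: "('a,'b) pre_digraph \<Rightarrow> 'a \<Rightarrow> bool" where
  "cut_vertex G v \<longleftrightarrow> v \<in> verts G \<and> verts G \<noteq> {v} \<and> \<not> graph_connected (G \<restriction> (verts G - {v}))"

text \<open>Blocks (maximal connected subgraphs without a cut vertex) are induced subgraphs, so they
  are given by their vertex sets.\<close>

definition nonseparable :: "('a,'b) pre_digraph \<Rightarrow> bool" where
  "nonseparable G \<longleftrightarrow> graph_connected G \<and> (\<forall>v. \<not> cut_vertex G v)"

definition block :: "('a,'b) pre_digraph \<Rightarrow> 'a set \<Rightarrow> bool" where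
  "block G B \<longleftrightarrow> B \<subseteq> verts G \<and> nonseparable (G \<restriction> B) \<and>
     (\<forall>B'. B \<subset> B' \<and> B' \<subseteq> verts G \<longrightarrow> \<not> nonseparable (G \<restriction> B'))"

definition block_graph :: "('a,'b) pre_digraph \<Rightarrow> bool" where
  "block_graph G \<longleftrightarrow> graph G \<and> graph_connected G \<and> (\<forall>B. block G B \<longrightarrow> clique G B)"

text \<open>\<open>W\<close> is the vertex set of the block graph one starts from; the remaining vertices are the
  added ones, each of them a true twin of a vertex of \<open>W\<close>.\<close>

definition strictly_chordal :: "('a,'b) pre_digraph \<Rightarrow> bool" where
  "strictly_chordal G \<longleftrightarrow> graph G \<and> graph_connected G \<and>
     (\<exists>W \<subseteq> verts G. block_graph (G \<restriction> W) \<and>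
        (\<forall>v \<in> verts G - W. \<exists>u\<in>W. closed_nbhd G v = closed_nbhd G u))"

definition interval_graph :: "('a,'b) pre_digraph \<Rightarrow> bool" where
  "interval_graph G \<longleftrightarrow> graph G \<and>
     (\<exists>l r :: 'a \<Rightarrow> real. (\<forall>v\<in>verts G. l v \<le> r v) \<and>
        (\<forall>u\<in>verts G. \<forall>v\<in>verts G. u \<noteq> v \<longrightarrow>
           (u \<rightarrow>\<^bsub>G\<^esub> v \<longleftrightarrow> {l u..r u} \<inter> {l v..r v} \<noteq> {})))"

definition strictly_interval :: "('a,'b) pre_digraph \<Rightarrow> bool" where
  "strictly_interval G \<longleftrightarrow> strictly_chordal G \<and> interval_graph G"

definition adjacent_to_set :: "('a,'b) pre_digraph \<Rightarrow> 'a \<Rightarrow> 'a set \<Rightarrow> bool" where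
  "adjacent_to_set G v S \<longleftrightarrow> v \<notin> S \<and> (\<exists>u\<in>S. v \<rightarrow>\<^bsub>G\<^esub> u)"

definition SI_core :: "nat \<Rightarrow> nat \<Rightarrow> ('a,'b) pre_digraph \<Rightarrow> bool" where
  "SI_core s p G \<longleftrightarrow> strictly_interval G \<and>
     (\<exists>S\<^sub>1 S\<^sub>2. S\<^sub>1 \<noteq> S\<^sub>2 \<and> {S. minimal_vertex_separator G S} = {S\<^sub>1, S\<^sub>2} \<and>
        card S\<^sub>1 = s \<and> card S\<^sub>2 = s \<and>
        maximal_clique G (S\<^sub>1 \<union> S\<^sub>2) \<and> card (S\<^sub>1 \<union> S\<^sub>2) = 2 * s \<and>
        card {v. simplicial G v \<and> adjacent_to_set G v S\<^sub>1} = p \<and>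
        card {v. simplicial G v \<and> adjacent_to_set G v S\<^sub>2} = p)"

text \<open>Every finite simple graph is isomorphic to one whose vertices are natural numbers and whose
  arcs are ordered pairs of vertices, so these represent all isomorphism classes.\<close>

definition SI_core_graphs :: "nat \<Rightarrow> nat \<Rightarrow> nat pair_pre_digraph set" where
  "SI_core_graphs s p = {G. SI_core s p (with_proj G)}"

definition iso_on :: "'a pair_pre_digraph set \<Rightarrow> 'a pair_pre_digraph rel" where
  "iso_on \<G> = {(G, H). G \<in> \<G> \<and> H \<in> \<G> \<and> digraph_iso (with_proj G) (with_proj H)}"

definition num_nonisomorphic :: "'a pair_pre_digraph set \<Rightarrow> nat" where
  "num_nonisomorphic \<G> = card (\<G> // iso_on \<G>)"

definition num_partitions :: "nat \<Rightarrow> nat" where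
  "num_partitions n = card {M :: nat multiset. 0 \<notin># M \<and> sum_mset M = n}"

end

theory Submission
  imports Defs
begin

text \<open>
  Every pair of non-adjacent vertices is separated by some minimal vertex separator, hence by
  \<open>S\<^sub>1\<close> or \<open>S\<^sub>2\<close>. This alone determines the structure of a connected graph whose only minimal vertex
  separators are \<open>S\<^sub>1\<close> and \<open>S\<^sub>2\<close>, if these are disjoint and their union is a maximal clique. A vertex
  outside the union misses one of its vertices, so it is cut off by one of \<open>S\<^sub>1\<close>, \<open>S\<^sub>2\<close> from the other;
  it is not cut off in both ways, by connectedness, and therefore it is adjacent to all of the
  separator that cuts it off. Adjacency outside the union is transitive, because a middle vertex
  \<open>y\<close> of a path \<open>x\<close>, \<open>y\<close>, \<open>z\<close> with \<open>x\<close>, \<open>z\<close> non-adjacent would have to lie in \<open>S\<^sub>1\<close> or \<open>S\<^sub>2\<close>.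

  So the graph consists of the clique on the union with disjoint cliques attached to \<open>S\<^sub>1\<close> and to \<open>S\<^sub>2\<close>.
  As the separators are intrinsic, the isomorphism type amounts to the unordered pair of the two
  multisets of sizes of the attached cliques, which can be any two partitions of \<open>p\<close>.
\<close>

section \<open>Partitions as fibre sizes\<close>

definition class_of :: "('a \<Rightarrow> 'b) \<Rightarrow> 'a set \<Rightarrow> 'a \<Rightarrow> 'a set" where
  "class_of c P x = {y\<in>P. c y = c x}"

text \<open>For finite \<open>P\<close>, the fibres of \<open>c\<close> read as a partition of the
  number \<open>card P\<close>. Each fibre counts once, and the multiset keeps repeated
  sizes.\<close>

definition class_sizes :: "('a \<Rightarrow> 'b) \<Rightarrow> 'a set \<Rightarrow> nat multiset" where
  "class_sizes c P = image_mset card (mset_set (class_of c P ` P))"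

text \<open>Fibres over the same value are equinumerous, so bijections between them can be chosen
  separately; they glue because distinct fibres are disjoint.\<close>

lemma bij_betw_fibrewise:
  assumes "finite A" "finite B" "\<And>k. card {x\<in>A. f x = k} = card {x\<in>B. g x = k}"
  obtains h where "bij_betw h A B" "\<And>x. x \<in> A \<Longrightarrow> g (h x) = f x"
proof -
  have "\<exists>b. bij_betw b {x\<in>A. f x = k} {x\<in>B. g x = k}" for k
    using assms by (intro finite_same_card_bij) auto
  then obtain b where b: "bij_betw (b k) {x\<in>A. f x = k} {x\<in>B. g x = k}" for k
    by metis
  define h where "h x = b (f x) x" for x
  have img: "h x \<in> B \<and> g (h x) = f x" if "x \<in> A" for x
    using b[of "f x"] that unfolding h_def bij_betw_def by blast
  have "inj_on h A"
  proof (rule inj_onI)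
    fix x y assume xy: "x \<in> A" "y \<in> A" "h x = h y"
    then have "f x = f y" using img by metis
    then show "x = y" using b[of "f x"] xy unfolding h_def bij_betw_def inj_on_def by auto
  qed
  moreover have "h ` A = B"
  proof
    show "B \<subseteq> h ` A"
    proof
      fix y assume "y \<in> B"
      then have "y \<in> b (g y) ` {x\<in>A. f x = g y}" using b[of "g y"] unfolding bij_betw_def by auto
      then show "y \<in> h ` A" unfolding h_def by force
    qed
  qed (use img in auto)
  ultimately show thesis using img that[of h] unfolding bij_betw_def by auto
qed

text \<open>Only the kernel of a labelling enters, so labellings with values in different types can
  be compared.\<close>

lemma class_sizes_cong:
  assumes "\<And>x y. x \<in> P \<Longrightarrow> y \<in> P \<Longrightarrow> c x = c y \<longleftrightarrow> c' x = c' y"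
  shows "class_sizes c P = class_sizes c' P"
proof -
  have "class_of c P ` P = class_of c' P ` P"
    using assms by (intro image_cong) (auto simp: class_of_def)
  then show ?thesis by (simp add: class_sizes_def)
qed

lemma class_sizes_image:
  assumes "inj_on h P"
  shows "class_sizes c (h ` P) = class_sizes (c \<circ> h) P"
proof -
  have "class_of c (h ` P) ` h ` P = (`) h ` class_of (c \<circ> h) P ` P"
    unfolding image_image by (intro image_cong) (auto simp: class_of_def)
  moreover have "inj_on ((`) h) (class_of (c \<circ> h) P ` P)"
    using assms by (rule inj_on_subset[OF inj_on_image_Pow]) (auto simp: class_of_def)
  ultimately have "mset_set (class_of c (h ` P) ` h ` P)
      = image_mset ((`) h) (mset_set (class_of (c \<circ> h) P ` P))"
    by (simp add: image_mset_mset_set)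
  moreover have "card (h ` X) = card X" if "X \<in># mset_set (class_of (c \<circ> h) P ` P)" for X
  proof -
    have "X \<in> class_of (c \<circ> h) P ` P"
      using that by (cases "finite (class_of (c \<circ> h) P ` P)") auto
    then have "X \<subseteq> P" by (auto simp: class_of_def)
    then show ?thesis using assms card_image inj_on_subset by metis
  qed
  ultimately show ?thesis
    unfolding class_sizes_def by (simp only: image_mset.compositionality) (auto intro: image_mset_cong)
qed

lemma class_of_eq_iff:
  assumes "x \<in> P" "y \<in> P" shows "class_of c P x = class_of c P y \<longleftrightarrow> c x = c y"
  using assms by (auto simp: class_of_def)

text \<open>\<open>bij_betw_fibrewise\<close> is applied twice: to the sets of classes, indexed by
  size, which matches classes of equal size; then to the elements, indexed by the class they belong
  to under this matching.\<close>

lemma class_sizes_eqD: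
  assumes fin: "finite P" "finite Q" and eq: "class_sizes c P = class_sizes d Q"
  obtains h where "bij_betw h P Q" "\<And>x y. x \<in> P \<Longrightarrow> y \<in> P \<Longrightarrow> d (h x) = d (h y) \<longleftrightarrow> c x = c y"
proof -
  let ?K = "class_of c P ` P" and ?L = "class_of d Q ` Q"
  have count: "count (image_mset card (mset_set K)) n = card {X\<in>K. card X = n}" if "finite K"
    for K :: "'x set set" and n
    using that by (simp add: count_image_mset vimage_def Int_def conj_commute)
  have sizes: "card {X\<in>?K. card X = n} = card {X\<in>?L. card X = n}" for n
    using count[of ?K n] count[of ?L n] eq fin by (simp add: class_sizes_def)
  obtain g where g: "bij_betw g ?K ?L" "\<And>X. X \<in> ?K \<Longrightarrow> card (g X) = card X"
    by (rule bij_betw_fibrewise[OF finite_imageI[OF fin(1)] finite_imageI[OF fin(2)] sizes]) (rule that)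
  have g_inj: "inj_on g ?K" and g_surj: "g ` ?K = ?L" using g(1) by (simp_all add: bij_betw_def)
  have g_eq_iff: "g (class_of c P x) = g (class_of c P y) \<longleftrightarrow> c x = c y" if "x \<in> P" "y \<in> P" for x y
    using that class_of_eq_iff[of x P y c] inj_on_eq_iff[OF g_inj, of "class_of c P x" "class_of c P y"]
    by simp
  have fibres: "card {x\<in>P. g (class_of c P x) = Y} = card {x\<in>Q. class_of d Q x = Y}" for Y
  proof (cases "Y \<in> ?L")
    case True
    then obtain y where y: "y \<in> Q" "Y = class_of d Q y" by blast
    from True obtain x where x: "x \<in> P" "Y = g (class_of c P x)"
      unfolding g_surj[symmetric] by blast
    have "{z\<in>P. g (class_of c P z) = Y} = class_of c P x"
      using g_eq_iff x by (auto simp: class_of_def)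
    moreover have "{z\<in>Q. class_of d Q z = Y} = class_of d Q y"
      using y(1) class_of_eq_iff[of _ Q y d] unfolding y(2) by (auto simp: class_of_def)
    ultimately show ?thesis using g(2) x y by (metis imageI)
  next
    case False
    then have "{x\<in>P. g (class_of c P x) = Y} = {}" "{x\<in>Q. class_of d Q x = Y} = {}"
      using g_surj by blast+
    then show ?thesis by (simp only: card.empty)
  qed
  obtain h where h: "bij_betw h P Q" "\<And>x. x \<in> P \<Longrightarrow> class_of d Q (h x) = g (class_of c P x)"
    by (rule bij_betw_fibrewise[OF fin fibres]) (rule that)
  have "d (h x) = d (h y) \<longleftrightarrow> c x = c y" if "x \<in> P" "y \<in> P" for x y
  proof -
    have "h x \<in> Q" "h y \<in> Q" using h(1) that unfolding bij_betw_def by auto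
    then have "d (h x) = d (h y) \<longleftrightarrow> g (class_of c P x) = g (class_of c P y)"
      using h(2) that class_of_eq_iff[of "h x" Q "h y" d] by simp
    also have "\<dots> \<longleftrightarrow> c x = c y"
      using g_eq_iff that by blast
    finally show ?thesis .
  qed
  with h(1) show thesis using that by blast
qed

lemma class_sizes_partition:
  assumes "finite P"
  shows "sum_mset (class_sizes c P) = card P" "0 \<notin># class_sizes c P"
proof -
  have "sum_mset (class_sizes c P) = sum card (class_of c P ` P)"
    by (simp add: class_sizes_def sum_unfold_sum_mset)
  also have "\<dots> = card (\<Union>(class_of c P ` P))"
    using assms by (intro card_Union_disjoint[symmetric])
      (auto simp: class_of_def pairwise_def disjnt_def)
  also have "\<Union>(class_of c P ` P) = P" by (auto simp: class_of_def)
  finally show "sum_mset (class_sizes c P) = card P" .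
  show "0 \<notin># class_sizes c P"
    using assms by (auto simp: class_sizes_def class_of_def)
qed

text \<open>Induction on the parts: a subset of the size of the new part becomes one class, and the
  induction hypothesis labels the rest.\<close>

lemma class_sizes_realize:
  assumes "0 \<notin># M" "finite P" "card P = sum_mset M"
  obtains c :: "'a \<Rightarrow> nat" where "class_sizes c P = M"
proof -
  have "\<exists>c :: 'a \<Rightarrow> nat. class_sizes c P = M"
    using assms
  proof (induction M arbitrary: P)
    case empty
    then show ?case by (simp add: class_sizes_def)
  next
    case (add n M)
    then obtain Q where Q: "Q \<subseteq> P" "card Q = n" "finite Q"
      using obtain_subset_with_card_n[of n P] by auto
    have "card (P - Q) = sum_mset M" using add.prems Q by (simp add: card_Diff_subset)
    then obtain c :: "'a \<Rightarrow> nat" where c: "class_sizes c (P - Q) = M"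
      using add.IH[of "P - Q"] add.prems by auto
    \<comment> \<open>A fresh label keeps \<open>Q\<close> from merging with an older class.\<close>
    obtain k where k: "k \<notin> c ` (P - Q)"
      using ex_new_if_finite[of "c ` (P - Q)"] add.prems by auto
    define d where "d x = (if x \<in> Q then k else c x)" for x
    have "Q \<noteq> {}" using Q add.prems by auto
    have 1: "class_of d P x = Q" if "x \<in> Q" for x
      using that k Q by (auto simp: class_of_def d_def)
    have 2: "class_of d P x = class_of c (P - Q) x" if "x \<in> P - Q" for x
      using that k by (auto simp: class_of_def d_def)
    have "class_of d P ` P = class_of d P ` Q \<union> class_of d P ` (P - Q)"
      using Q by auto
    also have "\<dots> = insert Q (class_of c (P - Q) ` (P - Q))"
      using 1 2 \<open>Q \<noteq> {}\<close> by auto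
    finally have "class_of d P ` P = insert Q (class_of c (P - Q) ` (P - Q))" .
    moreover have "Q \<notin> class_of c (P - Q) ` (P - Q)"
      using \<open>Q \<noteq> {}\<close> by (auto simp: class_of_def)
    ultimately have "class_sizes d P = add_mset n (class_sizes c (P - Q))"
      using add.prems Q by (simp add: class_sizes_def)
    then show ?case using c by auto
  qed
  then show thesis using that by blast
qed

text \<open>Every partition of \<open>n\<close> arises from a labelling of \<open>{..<n}\<close> by
  values below \<open>n\<close>, and there are finitely many of these.\<close>

lemma finite_partitions: "finite {M :: nat multiset. 0 \<notin># M \<and> sum_mset M = n}"
proof -
  have "{M. 0 \<notin># M \<and> sum_mset M = n} \<subseteq> (\<lambda>c. class_sizes c {..<n}) ` ({..<n} \<rightarrow>\<^sub>E {..<n})"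
  proof
    fix M :: "nat multiset" assume "M \<in> {M. 0 \<notin># M \<and> sum_mset M = n}"
    then obtain c :: "nat \<Rightarrow> nat" where c: "class_sizes c {..<n} = M"
      using class_sizes_realize[of M "{..<n}"] by auto
    \<comment> \<open>Relabelling each element by the least element of its class keeps the kernel
      and makes all labels smaller than \<open>n\<close>.\<close>
    define d where "d = (\<lambda>x\<in>{..<n}. Min (class_of c {..<n} x))"
    have "Min (class_of c {..<n} x) \<in> class_of c {..<n} x" if "x < n" for x
      using that by (intro Min_in) (auto simp: class_of_def)
    then have min_less: "Min (class_of c {..<n} x) < n"
      and min_eq: "c (Min (class_of c {..<n} x)) = c x" if "x < n" for x
      using that unfolding class_of_def by blast+
    have "class_sizes c {..<n} = class_sizes d {..<n}"
    proof (rule class_sizes_cong)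
      fix x y assume xy: "x \<in> {..<n}" "y \<in> {..<n}"
      have "c (d z) = c z" if "z \<in> {..<n}" for z
        using min_eq[of z] that by (simp add: d_def)
      moreover have "d x = d y" if "c x = c y"
        using that xy by (simp add: d_def class_of_def)
      ultimately show "c x = c y \<longleftrightarrow> d x = d y"
        using xy by metis
    qed
    moreover have "d \<in> {..<n} \<rightarrow>\<^sub>E {..<n}"
      using min_less by (auto simp: d_def)
    ultimately show "M \<in> (\<lambda>c. class_sizes c {..<n}) ` ({..<n} \<rightarrow>\<^sub>E {..<n})"
      using c by auto
  qed
  then show ?thesis by (rule finite_subset) (auto intro: finite_PiE)
qed

section \<open>Counting unordered pairs and the classes of an invariant\<close>

lemma card_unordered_pairs:
  assumes "finite A"
  shows "card {{x, y} |x y. x \<in> A \<and> y \<in> A} = card A * (card A + 1) div 2"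
proof -
  let ?B = "\<lambda>k. {X. X \<subseteq> A \<and> card X = k}"
  \<comment> \<open>Since \<open>x = y\<close> is allowed, these are exactly the subsets of size 1
    or 2.\<close>
  have "{{x, y} |x y. x \<in> A \<and> y \<in> A} = ?B 1 \<union> ?B 2"
    by (auto simp: card_1_singleton_iff card_2_iff card_insert_if)
  also have "card \<dots> = (card A choose 1) + (card A choose 2)"
    using assms by (subst card_Un_disjoint) (auto simp: n_subsets)
  also have "\<dots> = card A * (card A + 1) div 2"
    by (cases "card A") (simp_all add: choose_two algebra_simps)
  finally show ?thesis .
qed

text \<open>Classes of the kernel of \<open>f\<close> correspond to values of \<open>f\<close>; this
  turns counting isomorphism classes into counting values of a complete invariant.\<close>

lemma card_quotient_invariant:
  "card (A // {(x, y). x \<in> A \<and> y \<in> A \<and> f x = f y}) = card (f ` A)"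
proof -
  let ?g = "\<lambda>k. {x\<in>A. f x = k}"
  have "A // {(x, y). x \<in> A \<and> y \<in> A \<and> f x = f y} = (\<lambda>x. {y\<in>A. f x = f y}) ` A"
    by (auto simp: quotient_def)
  also have "\<dots> = ?g ` f ` A"
    unfolding image_image by (intro image_cong) auto
  finally have "A // {(x, y). x \<in> A \<and> y \<in> A \<and> f x = f y} = ?g ` f ` A" .
  moreover have "inj_on ?g (f ` A)" by (rule inj_onI) blast
  ultimately show ?thesis by (simp add: card_image)
qed

section \<open>Separators and blocks\<close>

lemma adj_induce_iff: "u \<rightarrow>\<^bsub>G \<restriction> X\<^esub> v \<longleftrightarrow> u \<in> X \<and> v \<in> X \<and> u \<rightarrow>\<^bsub>G\<^esub> v"
  by (auto simp: arcs_ends_conv)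

lemma arcs_ends_induce: "arcs_ends (G \<restriction> X) = arcs_ends G \<inter> X \<times> X"
  by (auto simp: arcs_ends_conv)

lemma induce_induce: "X \<subseteq> Y \<Longrightarrow> (G \<restriction> Y) \<restriction> X = G \<restriction> X"
  by (auto simp: induce_subgraph_def)

text \<open>Induction along a walk. To refute reachability of a vertex, it suffices to give a closed
  set without it.\<close>

lemma reachable_closed:
  assumes "u \<rightarrow>\<^sup>*\<^bsub>G\<^esub> v" "u \<in> R" "\<And>x y. x \<in> R \<Longrightarrow> x \<rightarrow>\<^bsub>G\<^esub> y \<Longrightarrow> y \<in> R"
  shows "v \<in> R"
  using assms unfolding reachable_def by (induction rule: rtrancl_on_induct) auto

lemma (in graph) graph_induce:
  assumes "X \<subseteq> verts G" shows "graph (G \<restriction> X)"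
proof -
  interpret H: wf_digraph "G \<restriction> X" ..
  have "symmetric G" by (rule sym_arcs)
  show ?thesis
    using assms finite_subset[OF assms finite_verts] \<open>symmetric G\<close> no_loops no_multi_arcs
    by unfold_locales
      (auto simp: symmetric_def adj_induce_iff sym_def arc_to_ends_def)
qed

lemma (in graph) connected_iff_strongly_connected: "graph_connected G \<longleftrightarrow> strongly_connected G"
  using reachable_mk_symmetric_eq[OF sym_arcs]
  by (simp add: Digraph_Component.connected_def strongly_connected_def mk_symmetric_def)

lemma (in graph) adj_commute: "u \<rightarrow>\<^bsub>G\<^esub> v \<longleftrightarrow> v \<rightarrow>\<^bsub>G\<^esub> u"
  using sym_arcs by (auto simp: symmetric_def sym_def)

lemma (in graph) reachable_commute: "u \<rightarrow>\<^sup>*\<^bsub>G\<^esub> v \<longleftrightarrow> v \<rightarrow>\<^sup>*\<^bsub>G\<^esub> u"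
  using symmetric_reachable' by blast

lemma (in graph) separates_commute: "separates G S u v \<longleftrightarrow> separates G S v u"
  using graph.reachable_commute[OF graph_induce[of "verts G - S"]] unfolding separates_def by blast

lemma (in graph) reachable_stepI: 
  assumes "u \<rightarrow>\<^bsub>G\<^esub> w" "w \<rightarrow>\<^sup>*\<^bsub>G \<restriction> X\<^esub> v" "u \<in> X"
  shows "u \<rightarrow>\<^sup>*\<^bsub>G \<restriction> X\<^esub> v"
proof -
  interpret H: wf_digraph "G \<restriction> X" ..
  have "w \<in> X" using H.reachable_in_verts[OF assms(2)] by simp
  then show ?thesis using assms H.adj_reachable_trans adj_induce_iff by metis
qed

lemma (in graph) reachable_induce_refl: "v \<in> X \<Longrightarrow> v \<rightarrow>\<^sup>*\<^bsub>G \<restriction> X\<^esub> v"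
  by (rule wf_digraph.reachable_refl[OF wellformed_induce_subgraph]) simp

lemma (in graph) strongly_connectedI_root:
  assumes "r \<in> verts G" "\<And>v. v \<in> verts G \<Longrightarrow> v \<rightarrow>\<^sup>*\<^bsub>G\<^esub> r"
  shows "strongly_connected G"
  using assms reachable_trans reachable_commute unfolding strongly_connected_def by blast

text \<open>Otherwise the path \<open>u\<close>, \<open>w\<close>, \<open>v\<close> would avoid
  \<open>T\<close>. Minimality of separators and transitivity of adjacency rest on this
  later.\<close>

lemma (in graph) separates_common_neighbour:
  assumes "separates G T u v" "u \<rightarrow>\<^bsub>G\<^esub> w" "w \<rightarrow>\<^bsub>G\<^esub> v"
  shows "w \<in> T"
proof (rule ccontr)
  assume "w \<notin> T"
  then have "u \<rightarrow>\<^sup>*\<^bsub>G \<restriction> (verts G - T)\<^esub> v"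
    using assms adj_in_verts
    by (intro reachable_stepI[of u w] reachable_stepI[of w v] reachable_induce_refl)
      (auto simp: separates_def)
  then show False using assms(1) by (simp add: separates_def)
qed

lemma (in graph) separates_complement:
  assumes "u \<in> verts G" "v \<in> verts G" "u \<noteq> v" "\<not> u \<rightarrow>\<^bsub>G\<^esub> v"
  shows "separates G (verts G - {u, v}) u v"
proof -
  have "\<not> u \<rightarrow>\<^sup>*\<^bsub>G \<restriction> (verts G - (verts G - {u, v}))\<^esub> v"
    using assms no_loops adj_not_same by (auto dest: reachable_closed[where R = "{u}"] simp: adj_induce_iff)
  then show ?thesis using assms by (auto simp: separates_def)
qed

text \<open>The sets separating the pair form a finite family, nonempty by
  \<open>separates_complement\<close>, so one of them is inclusion-minimal.\<close>

lemma (in graph) ex_minimal_vertex_separator: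
  assumes "u \<in> verts G" "v \<in> verts G" "u \<noteq> v" "\<not> u \<rightarrow>\<^bsub>G\<^esub> v"
  obtains S where "minimal_vertex_separator G S" "separates G S u v"
proof -
  have "finite {T. separates G T u v}"
    by (rule finite_subset[of _ "Pow (verts G)"]) (auto simp: separates_def)
  moreover have "{T. separates G T u v} \<noteq> {}"
    using separates_complement[OF assms] by blast
  ultimately obtain S where "separates G S u v" "\<And>T. separates G T u v \<Longrightarrow> T \<subseteq> S \<Longrightarrow> S = T"
    using finite_has_minimal[of "{T. separates G T u v}"] by auto
  then show thesis using that assms unfolding minimal_vertex_separator_def by blast
qed

text \<open>A block cannot contain two non-adjacent vertices \<open>u\<close>, \<open>v\<close>, since the vertex separating them
  would be a cut vertex of it.\<close>

lemma (in graph) block_graph_if_separated_by_vertex: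
  assumes "graph_connected G"
    and sep: "\<And>u v. u \<in> verts G \<Longrightarrow> v \<in> verts G \<Longrightarrow> u \<noteq> v \<Longrightarrow> \<not> u \<rightarrow>\<^bsub>G\<^esub> v \<Longrightarrow> \<exists>s. separates G {s} u v"
  shows "block_graph G"
proof -
  have "clique G B" if "block G B" for B
  proof (rule ccontr)
    assume "\<not> clique G B"
    have B: "B \<subseteq> verts G" "nonseparable (G \<restriction> B)" using that by (auto simp: block_def)
    interpret GB: graph "G \<restriction> B" by (rule graph_induce[OF B(1)])
    obtain u v where uv: "u \<in> B" "v \<in> B" "u \<noteq> v" "\<not> u \<rightarrow>\<^bsub>G\<^esub> v"
      using \<open>\<not> clique G B\<close> B(1) by (auto simp: clique_def)
    then obtain s where s: "separates G {s} u v" using sep B(1) by blast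
    have not_reach: "\<not> u \<rightarrow>\<^sup>*\<^bsub>G \<restriction> X\<^esub> v" if "X \<subseteq> verts G - {s}" for X
      using s reachable_induce_ss that unfolding separates_def by blast
    have "u \<rightarrow>\<^sup>*\<^bsub>G \<restriction> B\<^esub> v"
      using B(2) uv GB.connected_iff_strongly_connected
      by (auto simp: nonseparable_def strongly_connected_def)
    \<comment> \<open>If \<open>s\<close> were outside \<open>B\<close>, a walk inside
      \<open>B\<close> would join \<open>u\<close> and \<open>v\<close> while avoiding
      \<open>s\<close>.\<close>
    then have "s \<in> B" using not_reach[of B] B(1) by blast
    have "graph (G \<restriction> (B - {s}))" using B(1) by (intro graph_induce) auto
    moreover have "u \<in> B - {s}" "v \<in> B - {s}" using s uv by (auto simp: separates_def)
    ultimately have "\<not> graph_connected (G \<restriction> (B - {s}))"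
      using not_reach[of "B - {s}"] B(1) graph.connected_iff_strongly_connected[of "G \<restriction> (B - {s})"]
      by (auto simp: strongly_connected_def)
    then have "cut_vertex (G \<restriction> B) s"
      using \<open>s \<in> B\<close> uv by (auto simp: cut_vertex_def induce_induce)
    then show False using B(2) by (simp add: nonseparable_def)
  qed
  then show ?thesis using assms(1) graph_axioms by (simp add: block_graph_def)
qed

section \<open>The structure of SI-core graphs\<close>

text \<open>The label \<open>c\<close> encodes the disjoint unions of cliques on \<open>P\<^sub>1\<close> and \<open>P\<^sub>2\<close>: two vertices of the
  same \<open>P\<^sub>i\<close> lie in the same clique iff they have the same label.\<close>

definition si_arcs :: "'a set \<Rightarrow> 'a set \<Rightarrow> 'a set \<Rightarrow> 'a set \<Rightarrow> ('a \<Rightarrow> nat) \<Rightarrow> 'a rel" where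
  "si_arcs S\<^sub>1 S\<^sub>2 P\<^sub>1 P\<^sub>2 c = {(u, v). u \<noteq> v \<and>
     (u \<in> S\<^sub>1 \<union> S\<^sub>2 \<and> v \<in> S\<^sub>1 \<union> S\<^sub>2 \<or>
      u \<in> S\<^sub>1 \<and> v \<in> P\<^sub>1 \<or> u \<in> P\<^sub>1 \<and> v \<in> S\<^sub>1 \<or> u \<in> P\<^sub>1 \<and> v \<in> P\<^sub>1 \<and> c u = c v \<or>
      u \<in> S\<^sub>2 \<and> v \<in> P\<^sub>2 \<or> u \<in> P\<^sub>2 \<and> v \<in> S\<^sub>2 \<or> u \<in> P\<^sub>2 \<and> v \<in> P\<^sub>2 \<and> c u = c v)}"

lemma si_arcs_commute: "(u, v) \<in> si_arcs S\<^sub>1 S\<^sub>2 P\<^sub>1 P\<^sub>2 c \<longleftrightarrow> (v, u) \<in> si_arcs S\<^sub>1 S\<^sub>2 P\<^sub>1 P\<^sub>2 c"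
  by (auto simp: si_arcs_def)

lemma si_arcs_swap: "si_arcs S\<^sub>1 S\<^sub>2 P\<^sub>1 P\<^sub>2 c = si_arcs S\<^sub>2 S\<^sub>1 P\<^sub>2 P\<^sub>1 c"
  by (auto simp: si_arcs_def)

lemma si_arcs_field:
  assumes "(u, v) \<in> si_arcs S\<^sub>1 S\<^sub>2 P\<^sub>1 P\<^sub>2 c"
  shows "u \<in> S\<^sub>1 \<union> S\<^sub>2 \<union> P\<^sub>1 \<union> P\<^sub>2" "v \<in> S\<^sub>1 \<union> S\<^sub>2 \<union> P\<^sub>1 \<union> P\<^sub>2"
  using assms by (auto simp: si_arcs_def)

lemma si_arcs_leaf:
  assumes "u \<in> P\<^sub>1" "u \<notin> S\<^sub>1 \<union> S\<^sub>2 \<union> P\<^sub>2"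
  shows "(u, v) \<in> si_arcs S\<^sub>1 S\<^sub>2 P\<^sub>1 P\<^sub>2 c \<longleftrightarrow> u \<noteq> v \<and> (v \<in> S\<^sub>1 \<or> v \<in> P\<^sub>1 \<and> c u = c v)"
  using assms by (auto simp: si_arcs_def)

text \<open>The pattern of arcs survives passing to an induced subgraph; this serves to thin each
  separator to one vertex.\<close>

lemma si_arcs_Int:
  "si_arcs S\<^sub>1 S\<^sub>2 P\<^sub>1 P\<^sub>2 c \<inter> W \<times> W = si_arcs (S\<^sub>1 \<inter> W) (S\<^sub>2 \<inter> W) (P\<^sub>1 \<inter> W) (P\<^sub>2 \<inter> W) c"
  by (auto simp: si_arcs_def)

text \<open>The explicit form of an SI-core graph. The sizes of the parts are left free so that the
  subgraph with one vertex kept from each separator is an instance too.\<close>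

locale si_structure = graph G for G (structure) +
  fixes S\<^sub>1 S\<^sub>2 P\<^sub>1 P\<^sub>2 :: "'a set" and c :: "'a \<Rightarrow> nat"
  assumes verts_eq: "verts G = S\<^sub>1 \<union> S\<^sub>2 \<union> P\<^sub>1 \<union> P\<^sub>2"
    and arcs_eq: "arcs_ends G = si_arcs S\<^sub>1 S\<^sub>2 P\<^sub>1 P\<^sub>2 c"
    and disjoint: "S\<^sub>1 \<inter> S\<^sub>2 = {}" "P\<^sub>1 \<inter> P\<^sub>2 = {}" "(S\<^sub>1 \<union> S\<^sub>2) \<inter> (P\<^sub>1 \<union> P\<^sub>2) = {}"
    and nonempty: "S\<^sub>1 \<noteq> {}" "S\<^sub>2 \<noteq> {}" "P\<^sub>1 \<noteq> {}" "P\<^sub>2 \<noteq> {}"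
begin

text \<open>Through this symmetry, statements about the left end are reused for the right
  one.\<close>

lemma swap: "si_structure G S\<^sub>2 S\<^sub>1 P\<^sub>2 P\<^sub>1 c"
  using verts_eq disjoint nonempty
  by unfold_locales (auto simp: arcs_eq si_arcs_def)

lemma finite_parts: "finite S\<^sub>1" "finite S\<^sub>2" "finite P\<^sub>1" "finite P\<^sub>2"
  using finite_verts unfolding verts_eq by auto

lemma adj_iff: "u \<rightarrow>\<^bsub>G\<^esub> v \<longleftrightarrow> (u, v) \<in> si_arcs S\<^sub>1 S\<^sub>2 P\<^sub>1 P\<^sub>2 c"
  by (simp add: arcs_eq)

text \<open>After deletion of \<open>S\<^sub>1\<close>, the clique of \<open>P\<^sub>1\<close>
  containing \<open>u\<close> is closed under adjacency, so nothing else is reachable from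
  \<open>u\<close>.\<close>

lemma separates_leaf:
  assumes "u \<in> P\<^sub>1" "v \<in> verts G - S\<^sub>1" "\<not> (v \<in> P\<^sub>1 \<and> c v = c u)"
  shows "separates G S\<^sub>1 u v"
proof -
  have "\<not> u \<rightarrow>\<^sup>*\<^bsub>G \<restriction> (verts G - S\<^sub>1)\<^esub> v"
  proof
    assume "u \<rightarrow>\<^sup>*\<^bsub>G \<restriction> (verts G - S\<^sub>1)\<^esub> v"
    then have "v \<in> {x \<in> P\<^sub>1. c x = c u}"
      by (rule reachable_closed) (use assms(1) disjoint in \<open>auto simp: adj_induce_iff adj_iff si_arcs_def\<close>)
    then show False using assms(3) by blast
  qed
  then show ?thesis using assms verts_eq disjoint by (auto simp: separates_def)
qed

text \<open>If \<open>v\<close> is not in \<open>P\<^sub>2\<close>, it lies in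
  \<open>S\<^sub>2\<close> or in another clique of \<open>P\<^sub>1\<close>, and every vertex of
  \<open>S\<^sub>1\<close> is a common neighbour of \<open>u\<close> and \<open>v\<close>. If it is,
  both separators separate the pair, and a vertex missed by \<open>T\<close> in each of them would
  give a path through these two vertices.\<close>

lemma separator_of_leaf:
  assumes "u \<in> P\<^sub>1" "v \<in> verts G" "u \<noteq> v" "\<not> u \<rightarrow>\<^bsub>G\<^esub> v" "separates G T u v"
  shows "S\<^sub>1 \<subseteq> T \<and> separates G S\<^sub>1 u v \<or> S\<^sub>2 \<subseteq> T \<and> separates G S\<^sub>2 u v"
proof -
  have "v \<in> verts G - S\<^sub>1" "\<not> (v \<in> P\<^sub>1 \<and> c v = c u)"
    using assms(1-4) disjoint by (auto simp: adj_iff si_arcs_def)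
  then have sep: "separates G S\<^sub>1 u v" using separates_leaf assms(1) by blast
  show ?thesis
  proof (cases "v \<in> P\<^sub>2")
    case False
    then have "u \<rightarrow>\<^bsub>G\<^esub> w \<and> w \<rightarrow>\<^bsub>G\<^esub> v" if "w \<in> S\<^sub>1" for w
      using that assms(1-4) verts_eq disjoint by (auto simp: adj_iff si_arcs_def)
    then show ?thesis using sep separates_common_neighbour[OF assms(5)] by blast
  next
    case True
    then have sep2: "separates G S\<^sub>2 u v"
      using si_structure.separates_leaf[OF swap, of v u] assms(1) disjoint verts_eq
      by (auto simp: separates_commute[of _ u])
    have "S\<^sub>1 \<subseteq> T \<or> S\<^sub>2 \<subseteq> T"
    proof (rule ccontr)
      assume "\<not> ?thesis"
      then obtain x y where "x \<in> S\<^sub>1 - T" "y \<in> S\<^sub>2 - T" by blast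
      then have "u \<rightarrow>\<^sup>*\<^bsub>G \<restriction> (verts G - T)\<^esub> v"
        using True assms(1,5) disjoint verts_eq
        by (intro reachable_stepI[of u x] reachable_stepI[of x y] reachable_stepI[of y v] reachable_induce_refl)
          (auto simp: separates_def adj_iff si_arcs_def)
      then show False using assms(5) by (simp add: separates_def)
    qed
    then show ?thesis using sep sep2 by blast
  qed
qed

text \<open>Non-adjacent vertices cannot both lie in the central clique, so one of them is in an
  attached clique; up to exchanging the vertices and the two ends this is
  \<open>separator_of_leaf\<close>.\<close>

lemma separator_of_nonadjacent:
  assumes "u \<in> verts G" "v \<in> verts G" "u \<noteq> v" "\<not> u \<rightarrow>\<^bsub>G\<^esub> v" "separates G T u v"
  shows "S\<^sub>1 \<subseteq> T \<and> separates G S\<^sub>1 u v \<or> S\<^sub>2 \<subseteq> T \<and> separates G S\<^sub>2 u v"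
proof -
  interpret swap: si_structure G S\<^sub>2 S\<^sub>1 P\<^sub>2 P\<^sub>1 c by (rule swap)
  have "u \<in> P\<^sub>1 \<or> u \<in> P\<^sub>2 \<or> v \<in> P\<^sub>1 \<or> v \<in> P\<^sub>2"
    using assms(1-4) verts_eq by (auto simp: adj_iff si_arcs_def)
  then show ?thesis
    using separator_of_leaf[of u v T] separator_of_leaf[of v u T]
      swap.separator_of_leaf[of u v T] swap.separator_of_leaf[of v u T] assms
      separates_commute[of _ u v] adj_commute[of u v] by metis
qed

lemma minimal_vertex_separator_left: "minimal_vertex_separator G S\<^sub>1"
proof -
  \<comment> \<open>For this pair every vertex of \<open>S\<^sub>1\<close> is a common neighbour, so
    no proper subset separates it.\<close>
  obtain u v where uv: "u \<in> P\<^sub>1" "v \<in> S\<^sub>2" using nonempty by blast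
  then have 1: "u \<in> verts G" "v \<in> verts G" "u \<noteq> v" "\<not> u \<rightarrow>\<^bsub>G\<^esub> v"
    using verts_eq disjoint by (auto simp: adj_iff si_arcs_def)
  have 2: "separates G S\<^sub>1 u v"
    using uv verts_eq disjoint by (intro separates_leaf) auto
  have "u \<rightarrow>\<^bsub>G\<^esub> w" "w \<rightarrow>\<^bsub>G\<^esub> v" if "w \<in> S\<^sub>1" for w
    using uv that disjoint by (auto simp: adj_iff si_arcs_def)
  then have "\<not> separates G T u v" if "T \<subset> S\<^sub>1" for T
    using separates_common_neighbour that by blast
  then show ?thesis using 1 2 unfolding minimal_vertex_separator_def by blast
qed

text \<open>A separating set of a pair contains one of the two sets that already separates this
  pair, and minimality makes them equal.\<close>

lemma minimal_vertex_separators: "{S. minimal_vertex_separator G S} = {S\<^sub>1, S\<^sub>2}"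
proof (intro equalityI subsetI)
  fix S assume "S \<in> {S. minimal_vertex_separator G S}"
  then obtain u v where uv: "u \<in> verts G" "v \<in> verts G" "u \<noteq> v" "\<not> u \<rightarrow>\<^bsub>G\<^esub> v" "separates G S u v"
      and minimal: "\<And>T. T \<subset> S \<Longrightarrow> \<not> separates G T u v"
    by (auto simp: minimal_vertex_separator_def)
  show "S \<in> {S\<^sub>1, S\<^sub>2}"
    using separator_of_nonadjacent[OF uv] minimal[of S\<^sub>1] minimal[of S\<^sub>2] by auto
qed (use minimal_vertex_separator_left si_structure.minimal_vertex_separator_left[OF swap] in auto)

lemma simplicial_left: "{v. simplicial G v \<and> adjacent_to_set G v S\<^sub>1} = P\<^sub>1"
proof (intro equalityI subsetI)
  fix v assume v: "v \<in> P\<^sub>1"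
  then have "nbhd G v = S\<^sub>1 \<union> {x \<in> P\<^sub>1. x \<noteq> v \<and> c x = c v}"
    using disjoint by (auto simp: nbhd_def adj_iff si_arcs_def)
  moreover have "clique G (S\<^sub>1 \<union> {x \<in> P\<^sub>1. x \<noteq> v \<and> c x = c v})"
    using verts_eq by (auto simp: clique_def adj_iff si_arcs_def)
  moreover obtain x where "x \<in> S\<^sub>1" using nonempty by blast
  then have "adjacent_to_set G v S\<^sub>1"
    using v disjoint by (auto simp: adjacent_to_set_def adj_iff si_arcs_def)
  ultimately show "v \<in> {v. simplicial G v \<and> adjacent_to_set G v S\<^sub>1}"
    using v verts_eq by (simp add: simplicial_def)
next
  fix v assume v: "v \<in> {v. simplicial G v \<and> adjacent_to_set G v S\<^sub>1}"
  obtain x y where xy: "x \<in> S\<^sub>1" "y \<in> P\<^sub>2" using nonempty by blast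
  \<comment> \<open>Vertices of the other separator are adjacent to this one as well, but they see
    the non-adjacent vertices \<open>x\<close> and \<open>y\<close>.\<close>
  have "v \<notin> S\<^sub>2"
  proof
    assume "v \<in> S\<^sub>2"
    then have "x \<in> nbhd G v" "y \<in> nbhd G v" "x \<noteq> y" "\<not> x \<rightarrow>\<^bsub>G\<^esub> y"
      using xy disjoint by (auto simp: nbhd_def adj_iff si_arcs_def)
    then show False using v by (auto simp: simplicial_def clique_def)
  qed
  then show "v \<in> P\<^sub>1"
    using v disjoint by (auto simp: adjacent_to_set_def adj_iff si_arcs_def)
qed

text \<open>A vertex of an attached clique misses the separator of the other end, so one vertex from
  each separator blocks any enlargement.\<close>

lemma maximal_clique_union: "maximal_clique G (S\<^sub>1 \<union> S\<^sub>2)"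
proof -
  obtain x y where xy: "x \<in> S\<^sub>1" "y \<in> S\<^sub>2" using nonempty by blast
  have "K \<subseteq> S\<^sub>1 \<union> S\<^sub>2" if "clique G K" "S\<^sub>1 \<union> S\<^sub>2 \<subseteq> K" for K
  proof
    fix v assume "v \<in> K"
    moreover have "x \<in> K" "y \<in> K" using that(2) xy by blast+
    ultimately have "v = x \<or> v \<rightarrow>\<^bsub>G\<^esub> x" "v = y \<or> v \<rightarrow>\<^bsub>G\<^esub> y"
      using that(1) unfolding clique_def by blast+
    then show "v \<in> S\<^sub>1 \<union> S\<^sub>2"
      using xy disjoint by (auto simp: adj_iff si_arcs_def)
  qed
  moreover have "clique G (S\<^sub>1 \<union> S\<^sub>2)"
    using verts_eq by (auto simp: clique_def adj_iff si_arcs_def)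
  ultimately show ?thesis unfolding maximal_clique_def by blast
qed

lemma connected: "graph_connected G"
proof -
  obtain x y where xy: "x \<in> S\<^sub>1" "y \<in> S\<^sub>2" using nonempty by blast
  have xy_adj: "y \<rightarrow>\<^sup>*\<^bsub>G\<^esub> x" 
    using xy disjoint by (intro reachable_adjI) (auto simp: adj_iff si_arcs_def)
  have "v \<rightarrow>\<^sup>*\<^bsub>G\<^esub> x" if v: "v \<in> verts G" for v
  proof -
    have "v = x \<or> v \<rightarrow>\<^bsub>G\<^esub> x \<or> v \<rightarrow>\<^bsub>G\<^esub> y"
      using v xy verts_eq by (auto simp: adj_iff si_arcs_def)
    then show ?thesis
      using xy_adj v adj_reachable_trans by auto
  qed
  then show ?thesis
    using connected_iff_strongly_connected strongly_connectedI_root[of x] xy verts_eq by blast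
qed

text \<open>A non-adjacent pair is separated by one of the two separators, here a single vertex. The
  complement of the pair serves as the separating set to start from.\<close>

lemma block_graph_if_singletons:
  assumes "S\<^sub>1 = {x}" "S\<^sub>2 = {y}" shows "block_graph G"
proof (rule block_graph_if_separated_by_vertex[OF connected])
  fix u v assume "u \<in> verts G" "v \<in> verts G" "u \<noteq> v" "\<not> u \<rightarrow>\<^bsub>G\<^esub> v"
  then show "\<exists>s. separates G {s} u v"
    using separator_of_nonadjacent separates_complement assms by metis
qed

section \<open>Strict chordality and an interval model\<close>

lemma twin_left: "u \<in> S\<^sub>1 \<Longrightarrow> closed_nbhd G u = S\<^sub>1 \<union> S\<^sub>2 \<union> P\<^sub>1"
  using disjoint by (auto simp: closed_nbhd_def nbhd_def adj_iff si_arcs_def)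

lemma strictly_chordal: "strictly_chordal G"
proof -
  obtain x y where xy: "x \<in> S\<^sub>1" "y \<in> S\<^sub>2" using nonempty by blast
  \<comment> \<open>One representative of each separator is kept; the other vertices of that
    separator are its true twins.\<close>
  let ?W = "{x} \<union> {y} \<union> P\<^sub>1 \<union> P\<^sub>2"
  have W: "?W \<subseteq> verts G" using xy verts_eq by auto
  interpret W: graph "G \<restriction> ?W" by (rule graph_induce[OF W])
  have "S\<^sub>1 \<inter> ?W = {x}" "S\<^sub>2 \<inter> ?W = {y}" "P\<^sub>1 \<inter> ?W = P\<^sub>1" "P\<^sub>2 \<inter> ?W = P\<^sub>2"
    using xy disjoint by blast+
  then have "arcs_ends (G \<restriction> ?W) = si_arcs {x} {y} P\<^sub>1 P\<^sub>2 c"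
    by (simp only: arcs_ends_induce arcs_eq si_arcs_Int)
  then interpret W: si_structure "G \<restriction> ?W" "{x}" "{y}" P\<^sub>1 P\<^sub>2 c
    using xy disjoint nonempty by unfold_locales auto
  have "\<exists>u\<in>?W. closed_nbhd G v = closed_nbhd G u" if "v \<in> verts G - ?W" for v
    using that xy verts_eq twin_left si_structure.twin_left[OF swap] by auto
  then show ?thesis
    unfolding strictly_chordal_def
    using W graph_axioms connected W.block_graph_if_singletons[OF refl refl]
    by (intro conjI exI[of _ ?W] ballI)
qed

lemma interval_graph: "interval_graph G"
proof -
  \<comment> \<open>The cliques of \<open>P\<^sub>1\<close> become points left of 0 and those of \<open>P\<^sub>2\<close> points right of 0, while the
    intervals of \<open>S\<^sub>1\<close> and \<open>S\<^sub>2\<close> meet in 0 only.\<close>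
  define m where "m = Max (c ` verts G)"
  have m: "c v \<le> m" if "v \<in> verts G" for v
    using that by (simp add: m_def)
  \<comment> \<open>As \<open>m\<close> bounds the labels, the long intervals cover all points on
    their side. The shift by 1 keeps these points away from 0 even for label 0, and points on one
    side coincide only for equal labels.\<close>
  define l :: "'a \<Rightarrow> real" where
    "l v = (if v \<in> S\<^sub>1 then - 1 - m else if v \<in> S\<^sub>2 then 0 else if v \<in> P\<^sub>1 then - 1 - c v else 1 + c v)" for v
  define r :: "'a \<Rightarrow> real" where
    "r v = (if v \<in> S\<^sub>1 then 0 else if v \<in> S\<^sub>2 then 1 + m else if v \<in> P\<^sub>1 then - 1 - c v else 1 + c v)" for v
  have le: "l v \<le> r v" for v by (simp add: l_def r_def)
  have meet: "{l u..r u} \<inter> {l v..r v} \<noteq> {} \<longleftrightarrow> l u \<le> r v \<and> l v \<le> r u" for u v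
    using le[of u] le[of v] by (auto simp: Int_atLeastAtMost)
  have adj: "u \<rightarrow>\<^bsub>G\<^esub> v \<longleftrightarrow> l u \<le> r v \<and> l v \<le> r u" if "u \<in> verts G" "v \<in> verts G" "u \<noteq> v" for u v
    using that m[of u] m[of v] disjoint
    unfolding adj_iff si_arcs_def l_def r_def verts_eq
    by auto
  show ?thesis
    unfolding interval_graph_def
    using graph_axioms le meet adj by (intro conjI exI[of _ l] exI[of _ r]) auto
qed

lemma SI_core:
  assumes "card S\<^sub>1 = s" "card S\<^sub>2 = s" "card P\<^sub>1 = p" "card P\<^sub>2 = p"
  shows "SI_core s p G"
proof -
  have "S\<^sub>1 \<noteq> S\<^sub>2" using disjoint nonempty by blast
  moreover have "card (S\<^sub>1 \<union> S\<^sub>2) = 2 * s"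
    using assms disjoint finite_parts by (simp add: card_Un_disjoint)
  ultimately show ?thesis
    unfolding SI_core_def strictly_interval_def
    using assms minimal_vertex_separators maximal_clique_union strictly_chordal interval_graph
    by (intro conjI exI[of _ S\<^sub>1] exI[of _ S\<^sub>2])
      (simp_all add: simplicial_left si_structure.simplicial_left[OF swap])
qed

end

section \<open>Graphs with two disjoint minimal vertex separators\<close>

text \<open>This is used for cliques \<open>B\<close> disjoint from \<open>A\<close>, where the choice of \<open>q\<close> is immaterial.\<close>

definition side :: "('a,'b) pre_digraph \<Rightarrow> 'a set \<Rightarrow> 'a set \<Rightarrow> 'a set" where
  "side G A B = {v \<in> verts G - (A \<union> B). \<exists>q\<in>B. separates G A v q}"

text \<open>The intrinsic counterpart of \<open>si_structure\<close>: the attached parts and the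
  label are to be recovered from the graph.\<close>

locale two_separators = graph G for G (structure) +
  fixes S\<^sub>1 S\<^sub>2 :: "'a set"
  assumes connected: "graph_connected G"
    and separators: "{S. minimal_vertex_separator G S} = {S\<^sub>1, S\<^sub>2}"
    and maximal_clique: "maximal_clique G (S\<^sub>1 \<union> S\<^sub>2)"
    and disjoint: "S\<^sub>1 \<inter> S\<^sub>2 = {}"
    and nonempty: "S\<^sub>1 \<noteq> {}" "S\<^sub>2 \<noteq> {}"
begin

lemma swap: "two_separators G S\<^sub>2 S\<^sub>1"
  using connected separators maximal_clique disjoint nonempty
  by unfold_locales (auto simp: Un_commute insert_commute)

lemma core_subset: "S\<^sub>1 \<subseteq> verts G" "S\<^sub>2 \<subseteq> verts G"
  using maximal_clique by (auto simp: maximal_clique_def clique_def)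

lemma core_adj: "u \<in> S\<^sub>1 \<union> S\<^sub>2 \<Longrightarrow> v \<in> S\<^sub>1 \<union> S\<^sub>2 \<Longrightarrow> u \<noteq> v \<Longrightarrow> u \<rightarrow>\<^bsub>G\<^esub> v"
  using maximal_clique unfolding maximal_clique_def clique_def by blast

lemma nonadjacent_separated:
  assumes "u \<in> verts G" "v \<in> verts G" "u \<noteq> v" "\<not> u \<rightarrow>\<^bsub>G\<^esub> v"
  shows "separates G S\<^sub>1 u v \<or> separates G S\<^sub>2 u v"
proof -
  obtain S where "S \<in> {S. minimal_vertex_separator G S}" "separates G S u v"
    using ex_minimal_vertex_separator[OF assms] by blast
  then show ?thesis unfolding separators by blast
qed

text \<open>By maximality \<open>v\<close> misses some \<open>q\<close> in the clique. A separator
  of \<open>v\<close> and \<open>q\<close> does not contain \<open>q\<close>, so \<open>q\<close>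
  lies in the other one.\<close>

lemma side_cover:
  assumes "v \<in> verts G" "v \<notin> S\<^sub>1 \<union> S\<^sub>2"
  shows "v \<in> side G S\<^sub>1 S\<^sub>2 \<union> side G S\<^sub>2 S\<^sub>1"
proof -
  have "\<not> clique G (insert v (S\<^sub>1 \<union> S\<^sub>2))"
    using maximal_clique assms(2) unfolding maximal_clique_def by blast
  then obtain q where q: "q \<in> S\<^sub>1 \<union> S\<^sub>2" "\<not> v \<rightarrow>\<^bsub>G\<^esub> q"
    using assms core_subset core_adj adj_commute[of v] unfolding clique_def by blast
  then have "separates G S\<^sub>1 v q \<or> separates G S\<^sub>2 v q"
    using assms core_subset by (intro nonadjacent_separated) auto
  then show ?thesis
    using q(1) assms unfolding side_def by (auto simp: separates_def)
qed

text \<open>\<open>S\<^sub>2\<close> stays a clique when \<open>S\<^sub>1\<close> is deleted, so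
  reaching one of its vertices means reaching all of them.\<close>

lemma side_not_reachable:
  assumes "v \<in> side G S\<^sub>1 S\<^sub>2" "x \<in> S\<^sub>2"
  shows "\<not> v \<rightarrow>\<^sup>*\<^bsub>G \<restriction> (verts G - S\<^sub>1)\<^esub> x"
proof
  assume reach: "v \<rightarrow>\<^sup>*\<^bsub>G \<restriction> (verts G - S\<^sub>1)\<^esub> x"
  interpret H: graph "G \<restriction> (verts G - S\<^sub>1)" by (rule graph_induce) auto
  obtain q where q: "q \<in> S\<^sub>2" "\<not> v \<rightarrow>\<^sup>*\<^bsub>G \<restriction> (verts G - S\<^sub>1)\<^esub> q"
    using assms(1) by (auto simp: side_def separates_def)
  have "x \<rightarrow>\<^bsub>G \<restriction> (verts G - S\<^sub>1)\<^esub> q" if "x \<noteq> q"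
    using that q(1) assms(2) core_adj core_subset disjoint by (auto simp: adj_induce_iff)
  then have "v \<rightarrow>\<^sup>*\<^bsub>G \<restriction> (verts G - S\<^sub>1)\<^esub> q"
    using reach H.reachable_adj_trans by (cases "x = q") auto
  then show False using q(2) by blast
qed

lemma sideI:
  assumes "v \<in> verts G - (S\<^sub>1 \<union> S\<^sub>2)" "x \<in> S\<^sub>2" "\<not> v \<rightarrow>\<^sup>*\<^bsub>G \<restriction> (verts G - S\<^sub>1)\<^esub> x"
  shows "v \<in> side G S\<^sub>1 S\<^sub>2"
  using assms core_subset disjoint by (auto simp: side_def separates_def)

text \<open>Any other neighbour \<open>w\<close> would reach \<open>S\<^sub>2\<close> while avoiding
  \<open>S\<^sub>1\<close>, and then so would \<open>v\<close> by way of \<open>w\<close>.\<close>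

lemma side_step:
  assumes "v \<in> side G S\<^sub>1 S\<^sub>2" "v \<rightarrow>\<^bsub>G\<^esub> w"
  shows "w \<in> S\<^sub>1 \<union> side G S\<^sub>1 S\<^sub>2"
proof (rule ccontr)
  assume w: "w \<notin> S\<^sub>1 \<union> side G S\<^sub>1 S\<^sub>2"
  obtain x where x: "x \<in> S\<^sub>2" using nonempty by blast
  have "w \<in> verts G" using assms(2) adj_in_verts by blast
  then have "\<exists>y\<in>S\<^sub>2. w \<rightarrow>\<^sup>*\<^bsub>G \<restriction> (verts G - S\<^sub>1)\<^esub> y"
    using w x sideI[of w x] reachable_induce_refl[of w "verts G - S\<^sub>1"] by blast
  moreover have "v \<in> verts G - S\<^sub>1" using assms(1) by (auto simp: side_def)
  ultimately show False
    using assms side_not_reachable reachable_stepI by blast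
qed

text \<open>By \<open>side_step\<close> for both sides the common part is closed under adjacency, so
  connectedness would put a vertex of \<open>S\<^sub>1\<close> into it.\<close>

lemma sides_disjoint: "side G S\<^sub>1 S\<^sub>2 \<inter> side G S\<^sub>2 S\<^sub>1 = {}"
proof (rule ccontr)
  interpret swap: two_separators G S\<^sub>2 S\<^sub>1 by (rule swap)
  let ?R = "side G S\<^sub>1 S\<^sub>2 \<inter> side G S\<^sub>2 S\<^sub>1"
  assume "?R \<noteq> {}"
  then obtain v where v: "v \<in> ?R" by blast
  obtain x where x: "x \<in> S\<^sub>1" using nonempty by blast
  have "v \<in> verts G" "x \<in> verts G" using v x core_subset by (auto simp: side_def)
  then have "v \<rightarrow>\<^sup>*\<^bsub>G\<^esub> x"
    using connected connected_iff_strongly_connected by (simp add: strongly_connected_def)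
  then have "x \<in> ?R"
  proof (rule reachable_closed)
    fix y z assume y: "y \<in> ?R" "y \<rightarrow>\<^bsub>G\<^esub> z"
    then have "z \<in> S\<^sub>1 \<union> side G S\<^sub>1 S\<^sub>2" "z \<in> S\<^sub>2 \<union> side G S\<^sub>2 S\<^sub>1"
      using side_step swap.side_step by blast+
    then show "z \<in> ?R" using disjoint by (auto simp: side_def)
  qed (rule v)
  then show False using x by (auto simp: side_def)
qed

text \<open>\<open>S\<^sub>1\<close> cannot separate \<open>v\<close> from its own member
  \<open>x\<close>, so without the edge \<open>S\<^sub>2\<close> would, and \<open>v\<close> would
  lie on both sides.\<close>

lemma side_adj_separator:
  assumes "v \<in> side G S\<^sub>1 S\<^sub>2" "x \<in> S\<^sub>1"
  shows "v \<rightarrow>\<^bsub>G\<^esub> x"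
proof (rule ccontr)
  assume "\<not> v \<rightarrow>\<^bsub>G\<^esub> x"
  then have "separates G S\<^sub>1 v x \<or> separates G S\<^sub>2 v x"
    using assms core_subset by (intro nonadjacent_separated) (auto simp: side_def)
  then have "separates G S\<^sub>2 v x" using assms(2) by (auto simp: separates_def)
  then have "v \<in> side G S\<^sub>2 S\<^sub>1" using assms by (auto simp: side_def)
  then show False using assms(1) sides_disjoint by blast
qed

lemma adj_trans_outside:
  assumes "x \<rightarrow>\<^bsub>G\<^esub> y" "y \<rightarrow>\<^bsub>G\<^esub> z" "x \<noteq> z" "y \<notin> S\<^sub>1 \<union> S\<^sub>2"
  shows "x \<rightarrow>\<^bsub>G\<^esub> z"
proof (rule ccontr)
  assume "\<not> x \<rightarrow>\<^bsub>G\<^esub> z"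
  then have "separates G S\<^sub>1 x z \<or> separates G S\<^sub>2 x z"
    using assms adj_in_verts by (intro nonadjacent_separated) auto
  then show False using separates_common_neighbour assms by blast
qed

text \<open>\<open>S\<^sub>1\<close> separates some pair. Were its side empty, every vertex left
  after deleting it would equal or see \<open>x\<close>, so the rest would be connected.\<close>

lemma side_nonempty: "side G S\<^sub>1 S\<^sub>2 \<noteq> {}"
proof
  interpret swap: two_separators G S\<^sub>2 S\<^sub>1 by (rule swap)
  assume empty: "side G S\<^sub>1 S\<^sub>2 = {}"
  obtain u v where uv: "separates G S\<^sub>1 u v"
  proof -
    have "S\<^sub>1 \<in> {S. minimal_vertex_separator G S}" unfolding separators by simp
    then show thesis using that by (auto simp: minimal_vertex_separator_def)
  qed
  obtain x where x: "x \<in> S\<^sub>2" using nonempty by blast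
  have "w \<rightarrow>\<^sup>*\<^bsub>G \<restriction> (verts G - S\<^sub>1)\<^esub> x" if w: "w \<in> verts G - S\<^sub>1" for w
  proof (cases "w = x")
    case True
    then show ?thesis using w by (simp add: reachable_induce_refl)
  next
    case False
    have "w \<in> S\<^sub>2 \<or> w \<in> side G S\<^sub>2 S\<^sub>1" using w side_cover empty by blast
    then have "w \<rightarrow>\<^bsub>G\<^esub> x" using False x core_adj swap.side_adj_separator by blast
    then show ?thesis
      using w x core_subset disjoint
      by (intro reachable_stepI[of w x] reachable_induce_refl) auto
  qed
  then have "u \<rightarrow>\<^sup>*\<^bsub>G \<restriction> (verts G - S\<^sub>1)\<^esub> x" "x \<rightarrow>\<^sup>*\<^bsub>G \<restriction> (verts G - S\<^sub>1)\<^esub> v"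
    using uv graph.reachable_commute[OF graph_induce[of "verts G - S\<^sub>1"]]
    unfolding separates_def by blast+
  then have "u \<rightarrow>\<^sup>*\<^bsub>G \<restriction> (verts G - S\<^sub>1)\<^esub> v"
    using wf_digraph.reachable_trans[OF wellformed_induce_subgraph] by metis
  then show False using uv by (simp add: separates_def)
qed

text \<open>Adjacency is transitive through vertices outside the separators, so adjacent vertices of
  a side are true twins. The twin classes are thus the attached cliques.\<close>

lemma side_closed_nbhd_eq_iff:
  assumes "u \<in> side G S\<^sub>1 S\<^sub>2" "v \<in> side G S\<^sub>1 S\<^sub>2"
  shows "closed_nbhd G u = closed_nbhd G v \<longleftrightarrow> u = v \<or> u \<rightarrow>\<^bsub>G\<^esub> v"
proof -
  have out: "u \<notin> S\<^sub>1 \<union> S\<^sub>2" "v \<notin> S\<^sub>1 \<union> S\<^sub>2" using assms by (auto simp: side_def)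
  have *: "closed_nbhd G x \<subseteq> closed_nbhd G y" if "x \<rightarrow>\<^bsub>G\<^esub> y" "x \<notin> S\<^sub>1 \<union> S\<^sub>2" for x y
    using that adj_trans_outside[of y x] adj_commute[of x y]
    by (auto simp: closed_nbhd_def nbhd_def)
  have "v \<in> closed_nbhd G v" by (simp add: closed_nbhd_def)
  then have "u = v \<or> u \<rightarrow>\<^bsub>G\<^esub> v" if "closed_nbhd G u = closed_nbhd G v"
    unfolding that[symmetric] by (auto simp: closed_nbhd_def nbhd_def)
  then show ?thesis using *[of u v] *[of v u] out adj_commute[of u v] by blast
qed

lemma ex_si_structure: "\<exists>c. si_structure G S\<^sub>1 S\<^sub>2 (side G S\<^sub>1 S\<^sub>2) (side G S\<^sub>2 S\<^sub>1) c"
proof -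
  interpret swap: two_separators G S\<^sub>2 S\<^sub>1 by (rule swap)
  let ?P = "side G S\<^sub>1 S\<^sub>2" and ?Q = "side G S\<^sub>2 S\<^sub>1"
  \<comment> \<open>Labels are natural numbers, so the finitely many closed neighbourhoods are
    numbered; on one side, equal labels then mean equal or adjacent.\<close>
  obtain label :: "'a set \<Rightarrow> nat" where label: "inj_on label (closed_nbhd G ` verts G)"
    using finite_imp_inj_to_nat_seg[of "closed_nbhd G ` verts G"] by auto
  define c where "c v = label (closed_nbhd G v)" for v
  have c: "c u = c v \<longleftrightarrow> closed_nbhd G u = closed_nbhd G v" if "u \<in> verts G" "v \<in> verts G" for u v
    using that inj_on_eq_iff[OF label] by (simp add: c_def)
  have verts: "verts G = S\<^sub>1 \<union> S\<^sub>2 \<union> ?P \<union> ?Q"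
    using side_cover core_subset by (auto simp: side_def)
  have out: "(S\<^sub>1 \<union> S\<^sub>2) \<inter> (?P \<union> ?Q) = {}" by (auto simp: side_def)
  have adjP: "u \<rightarrow>\<^bsub>G\<^esub> v \<longleftrightarrow> u \<noteq> v \<and> (v \<in> S\<^sub>1 \<or> v \<in> ?P \<and> c u = c v)" if "u \<in> ?P" for u v
    using that side_step side_adj_separator side_closed_nbhd_eq_iff[of u v] c[of u v] verts out
      adj_not_same by blast
  have adjQ: "u \<rightarrow>\<^bsub>G\<^esub> v \<longleftrightarrow> u \<noteq> v \<and> (v \<in> S\<^sub>2 \<or> v \<in> ?Q \<and> c u = c v)" if "u \<in> ?Q" for u v
    using that swap.side_step swap.side_adj_separator swap.side_closed_nbhd_eq_iff[of u v]
      c[of u v] verts out adj_not_same by blast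
  have adjS: "u \<rightarrow>\<^bsub>G\<^esub> v \<longleftrightarrow> u \<noteq> v" if "u \<in> S\<^sub>1 \<union> S\<^sub>2" "v \<in> S\<^sub>1 \<union> S\<^sub>2" for u v
    using that core_adj adj_not_same by blast
  have arcP: "(u, v) \<in> si_arcs S\<^sub>1 S\<^sub>2 ?P ?Q c \<longleftrightarrow> u \<noteq> v \<and> (v \<in> S\<^sub>1 \<or> v \<in> ?P \<and> c u = c v)"
    if "u \<in> ?P" for u v
    using that out sides_disjoint by (intro si_arcs_leaf) auto
  have arcQ: "(u, v) \<in> si_arcs S\<^sub>1 S\<^sub>2 ?P ?Q c \<longleftrightarrow> u \<noteq> v \<and> (v \<in> S\<^sub>2 \<or> v \<in> ?Q \<and> c u = c v)"
    if "u \<in> ?Q" for u v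
    unfolding si_arcs_swap[of S\<^sub>1] using that out sides_disjoint by (intro si_arcs_leaf) auto
  have "u \<rightarrow>\<^bsub>G\<^esub> v \<longleftrightarrow> (u, v) \<in> si_arcs S\<^sub>1 S\<^sub>2 ?P ?Q c" for u v
  proof (cases "u \<in> verts G \<and> v \<in> verts G")
    case False
    then show ?thesis using adj_in_verts[of u v] si_arcs_field verts by metis
  next
    case True
    then consider "u \<in> S\<^sub>1 \<union> S\<^sub>2" "v \<in> S\<^sub>1 \<union> S\<^sub>2" | "u \<in> ?P" | "u \<in> ?Q" | "v \<in> ?P" | "v \<in> ?Q"
      using verts by blast
    then show ?thesis
    proof cases
      case 1
      then show ?thesis by (simp add: adjS) (use out in \<open>auto simp: si_arcs_def\<close>)
    next
      case 2
      then show ?thesis using adjP[OF 2] arcP[OF 2] by simp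
    next
      case 3
      then show ?thesis using adjQ[OF 3] arcQ[OF 3] by simp
    next
      case 4
      then show ?thesis
        using adjP[OF 4] arcP[OF 4] adj_commute[of u] si_arcs_commute[of u] by simp
    next
      case 5
      then show ?thesis
        using adjQ[OF 5] arcQ[OF 5] adj_commute[of u] si_arcs_commute[of u] by simp
    qed
  qed
  then have "arcs_ends G = si_arcs S\<^sub>1 S\<^sub>2 ?P ?Q c" by auto
  then have "si_structure G S\<^sub>1 S\<^sub>2 ?P ?Q c"
    using verts out disjoint nonempty sides_disjoint side_nonempty swap.side_nonempty
    by unfold_locales auto
  then show ?thesis by blast
qed

end

lemma SI_core_obtain_structure:
  assumes "SI_core s p G" "s > 0"
  obtains S\<^sub>1 S\<^sub>2 P\<^sub>1 P\<^sub>2 c where "si_structure G S\<^sub>1 S\<^sub>2 P\<^sub>1 P\<^sub>2 c"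
    "card S\<^sub>1 = s" "card S\<^sub>2 = s" "card P\<^sub>1 = p" "card P\<^sub>2 = p"
proof -
  obtain S\<^sub>1 S\<^sub>2 where S: "{S. minimal_vertex_separator G S} = {S\<^sub>1, S\<^sub>2}"
      "card S\<^sub>1 = s" "card S\<^sub>2 = s" "maximal_clique G (S\<^sub>1 \<union> S\<^sub>2)" "card (S\<^sub>1 \<union> S\<^sub>2) = 2 * s"
      "card {v. simplicial G v \<and> adjacent_to_set G v S\<^sub>1} = p"
      "card {v. simplicial G v \<and> adjacent_to_set G v S\<^sub>2} = p"
    using assms(1) unfolding SI_core_def by (elim conjE exE) (rule that)
  have G: "graph G" "graph_connected G"
    using assms(1) by (auto simp: SI_core_def strictly_interval_def strictly_chordal_def)
  interpret graph G by (rule G)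
  \<comment> \<open>Infinite sets have cardinality 0, which \<open>s > 0\<close> excludes.\<close>
  have fin: "finite S\<^sub>1" "finite S\<^sub>2" using S(2,3) assms(2) card.infinite by fastforce+
  \<comment> \<open>A union of size \<open>2 * s\<close> of two sets of size \<open>s\<close> leaves
    no room for a common vertex.\<close>
  have "card (S\<^sub>1 \<inter> S\<^sub>2) = 0" using card_Un_Int[OF fin] S by simp
  then have "S\<^sub>1 \<inter> S\<^sub>2 = {}" using fin by simp
  moreover have "S\<^sub>1 \<noteq> {}" "S\<^sub>2 \<noteq> {}" using S(2,3) assms(2) by auto
  ultimately interpret two_separators G S\<^sub>1 S\<^sub>2
    using G S by unfold_locales
  obtain c where "si_structure G S\<^sub>1 S\<^sub>2 (side G S\<^sub>1 S\<^sub>2) (side G S\<^sub>2 S\<^sub>1) c"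
    using ex_si_structure by blast
  \<comment> \<open>The simplicial vertices next to a separator are exactly its side, which
    therefore has \<open>p\<close> elements.\<close>
  moreover from this have "{v. simplicial G v \<and> adjacent_to_set G v S\<^sub>1} = side G S\<^sub>1 S\<^sub>2"
    "{v. simplicial G v \<and> adjacent_to_set G v S\<^sub>2} = side G S\<^sub>2 S\<^sub>1"
    using si_structure.simplicial_left si_structure.swap by blast+
  ultimately show thesis using that S by simp
qed

section \<open>Isomorphism types\<close>

text \<open>In a pair digraph an arc is the pair of its ends, so the vertex map determines the arc
  map.\<close>

lemma digraph_iso_with_proj_iff:
  assumes "wf_digraph (with_proj G)" "wf_digraph (with_proj H)"
  shows "digraph_iso (with_proj G) (with_proj H) \<longleftrightarrow>
    (\<exists>f. bij_betw f (pverts G) (pverts H) \<and>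
      (\<forall>u\<in>pverts G. \<forall>v\<in>pverts G. (f u, f v) \<in> parcs H \<longleftrightarrow> (u, v) \<in> parcs G))"
    (is "?L \<longleftrightarrow> (\<exists>f. ?R f)")
proof
  assume ?L
  then obtain h where h: "pre_digraph.digraph_isomorphism (with_proj G) h"
      and H: "with_proj H = app_iso h (with_proj G)"
    by (auto simp: digraph_iso_def)
  let ?f = "iso_verts h"
  have inj: "inj_on ?f (pverts G)"
    using pre_digraph.digraph_isomorphism_inj_on_verts[OF h] by simp
  have "verts (with_proj H) = ?f ` verts (with_proj G)" unfolding H by simp
  then have "pverts H = ?f ` pverts G" by simp
  moreover have "arcs_ends (with_proj H) = (\<lambda>(u, v). (?f u, ?f v)) ` arcs_ends (with_proj G)"
    unfolding H by (rule wf_digraph.arcs_ends_app_iso_eq[OF assms(1) h])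
  then have arcs: "parcs H = (\<lambda>(u, v). (?f u, ?f v)) ` parcs G" by simp
  have "(u, v) \<in> parcs G" if asm: "u \<in> pverts G" "v \<in> pverts G" "(?f u, ?f v) \<in> parcs H" for u v
  proof -
    obtain u' v' where uv: "(u', v') \<in> parcs G" "?f u = ?f u'" "?f v = ?f v'"
      using asm(3) unfolding arcs by auto
    then have "u' \<in> pverts G" "v' \<in> pverts G"
      using assms(1) wf_digraph.adj_in_verts[of "with_proj G"] by auto
    then have "u = u'" "v = v'" using asm(1,2) uv(2,3) inj_onD[OF inj] by blast+
    then show ?thesis using uv(1) by simp
  qed
  moreover have "(?f u, ?f v) \<in> parcs H" if "(u, v) \<in> parcs G" for u v
    using that unfolding arcs by force
  ultimately have "?R ?f" using inj by (auto simp: bij_betw_def)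
  then show "\<exists>f. ?R f" by (intro exI)
next
  assume "\<exists>f. ?R f"
  then obtain f where bij: "bij_betw f (pverts G) (pverts H)"
      and adj: "\<And>u v. u \<in> pverts G \<Longrightarrow> v \<in> pverts G \<Longrightarrow> (f u, f v) \<in> parcs H \<longleftrightarrow> (u, v) \<in> parcs G"
    by blast
  let ?h = "\<lparr>iso_verts = f, iso_arcs = map_prod f f, iso_head = snd, iso_tail = fst\<rparr>"
  have subG: "parcs G \<subseteq> pverts G \<times> pverts G" and subH: "parcs H \<subseteq> pverts H \<times> pverts H"
    using assms wf_digraph.adj_in_verts[of "with_proj G"] wf_digraph.adj_in_verts[of "with_proj H"]
    by auto
  have inj: "inj_on f (pverts G)" using bij by (simp add: bij_betw_def)
  then have "inj_on (map_prod f f) (parcs G)"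
    using subG map_prod_inj_on inj_on_subset by blast
  then have "pre_digraph.digraph_isomorphism (with_proj G) ?h"
    using assms(1) inj by (simp add: pre_digraph.digraph_isomorphism_def)
  moreover have "map_prod f f ` parcs G = parcs H"
  proof (intro equalityI subsetI)
    fix a assume "a \<in> map_prod f f ` parcs G"
    then show "a \<in> parcs H" using subG adj by auto
  next
    fix a assume a: "a \<in> parcs H"
    then have "a \<in> f ` pverts G \<times> f ` pverts G" using subH bij by (auto simp: bij_betw_def)
    then obtain u v where uv: "u \<in> pverts G" "v \<in> pverts G" "a = (f u, f v)" by blast
    then have "(u, v) \<in> parcs G" using a adj by blast
    then show "a \<in> map_prod f f ` parcs G" using uv(3) by force
  qed
  then have "with_proj H = app_iso ?h (with_proj G)"
    using bij by (simp add: app_iso_def with_proj_def bij_betw_def)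
  ultimately show ?L unfolding digraph_iso_def by blast
qed

text \<open>An isomorphism describes the target graph by images of the source parts, each image
  vertex keeping the label of its source.\<close>

lemma (in si_structure) transport:
  assumes "graph H" and bij: "bij_betw f (verts G) (verts H)"
    and adj: "\<And>u v. u \<in> verts G \<Longrightarrow> v \<in> verts G \<Longrightarrow> f u \<rightarrow>\<^bsub>H\<^esub> f v \<longleftrightarrow> u \<rightarrow>\<^bsub>G\<^esub> v"
    and d: "\<And>v. v \<in> verts G \<Longrightarrow> d (f v) = c v"
  shows "si_structure H (f ` S\<^sub>1) (f ` S\<^sub>2) (f ` P\<^sub>1) (f ` P\<^sub>2) d"
proof -
  interpret H: graph H by fact
  have inj: "inj_on f (verts G)" and surj: "f ` verts G = verts H"
    using bij by (simp_all add: bij_betw_def)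
  have mem: "f v \<in> f ` X \<longleftrightarrow> v \<in> X" if "v \<in> verts G" "X \<subseteq> verts G" for v X
    using that inj inj_on_image_mem_iff by metis
  have sub: "S\<^sub>1 \<subseteq> verts G" "S\<^sub>2 \<subseteq> verts G" "P\<^sub>1 \<subseteq> verts G" "P\<^sub>2 \<subseteq> verts G"
    using verts_eq by auto
  have arcs: "f u \<rightarrow>\<^bsub>H\<^esub> f v \<longleftrightarrow> (f u, f v) \<in> si_arcs (f ` S\<^sub>1) (f ` S\<^sub>2) (f ` P\<^sub>1) (f ` P\<^sub>2) d"
    if uv: "u \<in> verts G" "v \<in> verts G" for u v
    using mem[OF uv(1)] mem[OF uv(2)] sub d uv inj_on_eq_iff[OF inj uv]
    unfolding adj[OF uv] adj_iff si_arcs_def by simp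
  have "si_arcs (f ` S\<^sub>1) (f ` S\<^sub>2) (f ` P\<^sub>1) (f ` P\<^sub>2) d \<subseteq> verts H \<times> verts H"
    unfolding surj[symmetric] verts_eq by (auto simp: si_arcs_def)
  then have "x \<rightarrow>\<^bsub>H\<^esub> y \<longleftrightarrow> (x, y) \<in> si_arcs (f ` S\<^sub>1) (f ` S\<^sub>2) (f ` P\<^sub>1) (f ` P\<^sub>2) d" for x y
    using arcs H.adj_in_verts[of x y] unfolding surj[symmetric] by blast
  then have "arcs_ends H = si_arcs (f ` S\<^sub>1) (f ` S\<^sub>2) (f ` P\<^sub>1) (f ` P\<^sub>2) d" by auto
  moreover have "f ` X \<inter> f ` Y = {}" if "X \<subseteq> verts G" "Y \<subseteq> verts G" "X \<inter> Y = {}" for X Y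
    using that inj_on_image_Int[OF inj that(1,2)] by simp
  then have "f ` S\<^sub>1 \<inter> f ` S\<^sub>2 = {}" "f ` P\<^sub>1 \<inter> f ` P\<^sub>2 = {}"
    "f ` (S\<^sub>1 \<union> S\<^sub>2) \<inter> f ` (P\<^sub>1 \<union> P\<^sub>2) = {}"
    using sub disjoint by auto
  moreover have "verts H = f ` S\<^sub>1 \<union> f ` S\<^sub>2 \<union> f ` P\<^sub>1 \<union> f ` P\<^sub>2"
    unfolding surj[symmetric] verts_eq by (simp add: image_Un)
  ultimately show ?thesis
    using nonempty by unfold_locales (auto simp: image_Un)
qed

text \<open>The complete invariant, in terms of the graph alone. With exactly two separators a plain
  set suffices: a singleton means that both partitions agree.\<close>

definition shape :: "('a,'b) pre_digraph \<Rightarrow> nat multiset set" where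
  "shape G = (\<lambda>S. class_sizes (closed_nbhd G) {v. simplicial G v \<and> adjacent_to_set G v S})
     ` {S. minimal_vertex_separator G S}"

text \<open>The closed neighbourhood of a vertex of \<open>P\<^sub>1\<close> is
  \<open>S\<^sub>1\<close> together with its clique, so it determines the label and
  conversely.\<close>

lemma (in si_structure) class_sizes_closed_nbhd: "class_sizes (closed_nbhd G) P\<^sub>1 = class_sizes c P\<^sub>1"
proof (rule class_sizes_cong)
  have nbhd: "closed_nbhd G v = S\<^sub>1 \<union> {x \<in> P\<^sub>1. c x = c v}" if "v \<in> P\<^sub>1" for v
    using that disjoint by (auto simp: closed_nbhd_def nbhd_def adj_iff si_arcs_def)
  fix u v assume uv: "u \<in> P\<^sub>1" "v \<in> P\<^sub>1"
  have "c u = c v" if "closed_nbhd G u = closed_nbhd G v"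
    using that uv disjoint unfolding nbhd[OF uv(1)] nbhd[OF uv(2)] by blast
  then show "closed_nbhd G u = closed_nbhd G v \<longleftrightarrow> c u = c v"
    using nbhd uv by auto
qed

lemma (in si_structure) shape_eq: "shape G = {class_sizes c P\<^sub>1, class_sizes c P\<^sub>2}"
proof -
  interpret swap: si_structure G S\<^sub>2 S\<^sub>1 P\<^sub>2 P\<^sub>1 c by (rule swap)
  show ?thesis
    unfolding shape_def minimal_vertex_separators
    by (simp add: simplicial_left swap.simplicial_left class_sizes_closed_nbhd
        swap.class_sizes_closed_nbhd)
qed

text \<open>Bijections of the four parts are glued; those on the attached parts come from
  \<open>class_sizes_eqD\<close> and respect the cliques.\<close>

lemma si_structure_isoE:
  assumes G: "si_structure G S\<^sub>1 S\<^sub>2 P\<^sub>1 P\<^sub>2 c" and H: "si_structure H T\<^sub>1 T\<^sub>2 Q\<^sub>1 Q\<^sub>2 d"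
    and card: "card S\<^sub>1 = card T\<^sub>1" "card S\<^sub>2 = card T\<^sub>2"
    and sizes: "class_sizes c P\<^sub>1 = class_sizes d Q\<^sub>1" "class_sizes c P\<^sub>2 = class_sizes d Q\<^sub>2"
  obtains f where "bij_betw f (verts G) (verts H)"
    "\<And>u v. u \<in> verts G \<Longrightarrow> v \<in> verts G \<Longrightarrow> f u \<rightarrow>\<^bsub>H\<^esub> f v \<longleftrightarrow> u \<rightarrow>\<^bsub>G\<^esub> v"
proof -
  interpret G: si_structure G S\<^sub>1 S\<^sub>2 P\<^sub>1 P\<^sub>2 c by fact
  interpret H: si_structure H T\<^sub>1 T\<^sub>2 Q\<^sub>1 Q\<^sub>2 d by fact
  obtain f\<^sub>1 where f1: "bij_betw f\<^sub>1 S\<^sub>1 T\<^sub>1"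
    using finite_same_card_bij[OF G.finite_parts(1) H.finite_parts(1) card(1)] by blast
  obtain f\<^sub>2 where f2: "bij_betw f\<^sub>2 S\<^sub>2 T\<^sub>2"
    using finite_same_card_bij[OF G.finite_parts(2) H.finite_parts(2) card(2)] by blast
  obtain g\<^sub>1 where g1: "bij_betw g\<^sub>1 P\<^sub>1 Q\<^sub>1"
      "\<And>x y. x \<in> P\<^sub>1 \<Longrightarrow> y \<in> P\<^sub>1 \<Longrightarrow> d (g\<^sub>1 x) = d (g\<^sub>1 y) \<longleftrightarrow> c x = c y"
    by (rule class_sizes_eqD[OF G.finite_parts(3) H.finite_parts(3) sizes(1)]) (rule that)
  obtain g\<^sub>2 where g2: "bij_betw g\<^sub>2 P\<^sub>2 Q\<^sub>2"
      "\<And>x y. x \<in> P\<^sub>2 \<Longrightarrow> y \<in> P\<^sub>2 \<Longrightarrow> d (g\<^sub>2 x) = d (g\<^sub>2 y) \<longleftrightarrow> c x = c y"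
    by (rule class_sizes_eqD[OF G.finite_parts(4) H.finite_parts(4) sizes(2)]) (rule that)
  define f where "f = (\<lambda>x. if x \<in> S\<^sub>1 then f\<^sub>1 x else if x \<in> S\<^sub>2 then f\<^sub>2 x
    else if x \<in> P\<^sub>1 then g\<^sub>1 x else g\<^sub>2 x)"
  have "bij_betw f (S\<^sub>1 \<union> (S\<^sub>2 \<union> (P\<^sub>1 \<union> P\<^sub>2))) (T\<^sub>1 \<union> (T\<^sub>2 \<union> (Q\<^sub>1 \<union> Q\<^sub>2)))"
    unfolding f_def
    by (intro bij_betw_disjoint_Un f1 f2 g1(1) g2(1)) (use G.disjoint H.disjoint in blast)+
  then have bij: "bij_betw f (verts G) (verts H)"
    by (simp add: G.verts_eq H.verts_eq Un_assoc)
  have maps: "x \<in> S\<^sub>1 \<Longrightarrow> f x \<in> T\<^sub>1" "x \<in> S\<^sub>2 \<Longrightarrow> f x \<in> T\<^sub>2"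
    "x \<in> P\<^sub>1 \<Longrightarrow> f x \<in> Q\<^sub>1 \<and> f x = g\<^sub>1 x" "x \<in> P\<^sub>2 \<Longrightarrow> f x \<in> Q\<^sub>2 \<and> f x = g\<^sub>2 x" for x
    using bij_betwE[OF f1] bij_betwE[OF f2] bij_betwE[OF g1(1)] bij_betwE[OF g2(1)] G.disjoint
    unfolding f_def by auto
  have mem: "(f x \<in> T\<^sub>1 \<longleftrightarrow> x \<in> S\<^sub>1) \<and> (f x \<in> T\<^sub>2 \<longleftrightarrow> x \<in> S\<^sub>2) \<and> (f x \<in> Q\<^sub>1 \<longleftrightarrow> x \<in> P\<^sub>1) \<and> (f x \<in> Q\<^sub>2 \<longleftrightarrow> x \<in> P\<^sub>2)"
    if "x \<in> verts G" for x
    using that maps[of x] G.disjoint H.disjoint unfolding G.verts_eq by blast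
  \<comment> \<open>Labels are compared within one end only, since a label of
    \<open>P\<^sub>1\<close> may recur in \<open>P\<^sub>2\<close>.\<close>
  have cls: "d (f x) = d (f y) \<longleftrightarrow> c x = c y" if "x \<in> P\<^sub>1 \<and> y \<in> P\<^sub>1 \<or> x \<in> P\<^sub>2 \<and> y \<in> P\<^sub>2" for x y
    using that by (elim disjE conjE) (simp_all add: maps(3,4) g1(2) g2(2))
  have "f u \<rightarrow>\<^bsub>H\<^esub> f v \<longleftrightarrow> u \<rightarrow>\<^bsub>G\<^esub> v" if uv: "u \<in> verts G" "v \<in> verts G" for u v
  proof -
    have "f u = f v \<longleftrightarrow> u = v" using bij uv by (auto simp: bij_betw_def inj_on_def)
    then show ?thesis
      unfolding G.adj_iff H.adj_iff si_arcs_def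
      by (simp add: mem[OF uv(1)] mem[OF uv(2)] cls cong: conj_cong)
  qed
  with bij show thesis using that by blast
qed

lemma SI_core_iso_iff_shape_eq:
  assumes core: "SI_core s p (with_proj G)" "SI_core s p (with_proj H)" and "s > 0"
  shows "digraph_iso (with_proj G) (with_proj H) \<longleftrightarrow> shape (with_proj G) = shape (with_proj H)"
proof -
  obtain S\<^sub>1 S\<^sub>2 P\<^sub>1 P\<^sub>2 c where G: "si_structure (with_proj G) S\<^sub>1 S\<^sub>2 P\<^sub>1 P\<^sub>2 c"
      and cardG: "card S\<^sub>1 = s" "card S\<^sub>2 = s"
    using core(1) \<open>s > 0\<close> by (rule SI_core_obtain_structure)
  obtain T\<^sub>1 T\<^sub>2 Q\<^sub>1 Q\<^sub>2 d where H: "si_structure (with_proj H) T\<^sub>1 T\<^sub>2 Q\<^sub>1 Q\<^sub>2 d"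
      and cardH: "card T\<^sub>1 = s" "card T\<^sub>2 = s"
    using core(2) \<open>s > 0\<close> by (rule SI_core_obtain_structure)
  interpret G: si_structure "with_proj G" S\<^sub>1 S\<^sub>2 P\<^sub>1 P\<^sub>2 c by (rule G)
  interpret H: si_structure "with_proj H" T\<^sub>1 T\<^sub>2 Q\<^sub>1 Q\<^sub>2 d by (rule H)
  note iso_iff = digraph_iso_with_proj_iff[OF G.wf_digraph H.wf_digraph]
  show ?thesis
  proof
    assume "digraph_iso (with_proj G) (with_proj H)"
    then obtain f where bij: "bij_betw f (verts (with_proj G)) (verts (with_proj H))"
        and adj: "\<And>u v. u \<in> verts (with_proj G) \<Longrightarrow> v \<in> verts (with_proj G) \<Longrightarrow>
          f u \<rightarrow>\<^bsub>with_proj H\<^esub> f v \<longleftrightarrow> u \<rightarrow>\<^bsub>with_proj G\<^esub> v"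
      unfolding iso_iff by auto
    define d' where "d' = c \<circ> the_inv_into (verts (with_proj G)) f"
    have inj: "inj_on f (verts (with_proj G))" using bij by (simp add: bij_betw_def)
    have d': "d' (f v) = c v" if "v \<in> verts (with_proj G)" for v
      using that the_inv_into_f_f[OF inj] by (simp add: d'_def)
    \<comment> \<open>Now \<open>H\<close> has two descriptions; as \<open>shape\<close> is
      intrinsic, it may be computed from the transported one.\<close>
    interpret fH: si_structure "with_proj H" "f ` S\<^sub>1" "f ` S\<^sub>2" "f ` P\<^sub>1" "f ` P\<^sub>2" d'
      using G.transport[OF H.graph_axioms bij adj d'] .
    have "class_sizes d' (f ` P) = class_sizes c P" if "P \<subseteq> verts (with_proj G)" for P
    proof -
      have "class_sizes d' (f ` P) = class_sizes (d' \<circ> f) P"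
        using that inj inj_on_subset by (intro class_sizes_image) blast
      also have "\<dots> = class_sizes c P"
        using that d' by (intro class_sizes_cong) (auto simp: subset_iff)
      finally show ?thesis .
    qed
    moreover have "P\<^sub>1 \<subseteq> verts (with_proj G)" "P\<^sub>2 \<subseteq> verts (with_proj G)"
      unfolding G.verts_eq by auto
    ultimately show "shape (with_proj G) = shape (with_proj H)"
      unfolding G.shape_eq fH.shape_eq by simp
  next
    assume "shape (with_proj G) = shape (with_proj H)"
    \<comment> \<open>Equality of unordered pairs leaves two cases; in the crossed one the ends of
      \<open>H\<close> are exchanged.\<close>
    then consider "class_sizes c P\<^sub>1 = class_sizes d Q\<^sub>1" "class_sizes c P\<^sub>2 = class_sizes d Q\<^sub>2"
      | "class_sizes c P\<^sub>1 = class_sizes d Q\<^sub>2" "class_sizes c P\<^sub>2 = class_sizes d Q\<^sub>1"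
      unfolding G.shape_eq H.shape_eq doubleton_eq_iff by blast
    then obtain f where "bij_betw f (verts (with_proj G)) (verts (with_proj H))"
      "\<And>u v. u \<in> verts (with_proj G) \<Longrightarrow> v \<in> verts (with_proj G) \<Longrightarrow>
          f u \<rightarrow>\<^bsub>with_proj H\<^esub> f v \<longleftrightarrow> u \<rightarrow>\<^bsub>with_proj G\<^esub> v"
    proof cases
      case 1
      show thesis
        by (rule si_structure_isoE[OF G H _ _ 1]) (use cardG cardH in simp, use cardG cardH in simp, rule that)
    next
      case 2
      show thesis
        by (rule si_structure_isoE[OF G H.swap _ _ 2]) (use cardG cardH in simp, use cardG cardH in simp, rule that)
    qed
    then show "digraph_iso (with_proj G) (with_proj H)"
      unfolding iso_iff by auto
  qed
qed

section \<open>The values of the invariant and the count\<close>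

lemma SI_core_shape:
  assumes "SI_core s p G" "s > 0"
  obtains M N where "shape G = {M, N}" "0 \<notin># M" "sum_mset M = p" "0 \<notin># N" "sum_mset N = p"
proof -
  obtain S\<^sub>1 S\<^sub>2 P\<^sub>1 P\<^sub>2 c where G: "si_structure G S\<^sub>1 S\<^sub>2 P\<^sub>1 P\<^sub>2 c"
      and card: "card P\<^sub>1 = p" "card P\<^sub>2 = p"
    using assms by (rule SI_core_obtain_structure)
  interpret si_structure G S\<^sub>1 S\<^sub>2 P\<^sub>1 P\<^sub>2 c by (rule G)
  show thesis
    using that[OF shape_eq] class_sizes_partition finite_parts card by metis
qed

lemma SI_core_realize:
  assumes "s > 0" "p > 0" and M: "0 \<notin># M" "sum_mset M = p" and N: "0 \<notin># N" "sum_mset N = p"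
  obtains G :: "nat pair_pre_digraph" where "SI_core s p (with_proj G)" "shape (with_proj G) = {M, N}"
proof -
  \<comment> \<open>The parts are consecutive intervals of natural numbers, of lengths
    \<open>s\<close>, \<open>s\<close>, \<open>p\<close>, \<open>p\<close>.\<close>
  let ?S\<^sub>1 = "{..<s}" and ?S\<^sub>2 = "{s..<2 * s}"
  let ?P\<^sub>1 = "{2 * s..<2 * s + p}" and ?P\<^sub>2 = "{2 * s + p..<2 * s + 2 * p}"
  obtain c\<^sub>1 :: "nat \<Rightarrow> nat" where c1: "class_sizes c\<^sub>1 ?P\<^sub>1 = M"
    using class_sizes_realize[of M ?P\<^sub>1] M by auto
  obtain c\<^sub>2 :: "nat \<Rightarrow> nat" where c2: "class_sizes c\<^sub>2 ?P\<^sub>2 = N"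
    using class_sizes_realize[of N ?P\<^sub>2] N by auto
  define c where "c v = (if v \<in> ?P\<^sub>1 then c\<^sub>1 v else c\<^sub>2 v)" for v
  have c: "class_sizes c ?P\<^sub>1 = M" "class_sizes c ?P\<^sub>2 = N"
    unfolding c1[symmetric] c2[symmetric] by (intro class_sizes_cong; simp add: c_def)+
  define G where "G = \<lparr>pverts = {..<2 * s + 2 * p}, parcs = si_arcs ?S\<^sub>1 ?S\<^sub>2 ?P\<^sub>1 ?P\<^sub>2 c\<rparr>"
  have sub: "parcs G \<subseteq> pverts G \<times> pverts G"
    by (auto simp: G_def si_arcs_def)
  have "pair_graph G"
  proof
    show "finite (parcs G)" using sub finite_subset by (fastforce simp: G_def)
    show "finite (pverts G)" by (simp add: G_def)
    show "symmetric (with_proj G)"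
      by (auto simp: symmetric_def G_def intro!: symI intro: si_arcs_commute[THEN iffD1])
    fix e assume "e \<in> parcs G"
    then show "fst e \<in> pverts G" "snd e \<in> pverts G" using sub by auto
    show "fst e \<noteq> snd e" using \<open>e \<in> parcs G\<close> by (auto simp: G_def si_arcs_def)
  qed
  then interpret graph "with_proj G" by (rule pair_graph.pair_graphD_graph)
  interpret si_structure "with_proj G" ?S\<^sub>1 ?S\<^sub>2 ?P\<^sub>1 ?P\<^sub>2 c
  proof
    show "arcs_ends (with_proj G) = si_arcs ?S\<^sub>1 ?S\<^sub>2 ?P\<^sub>1 ?P\<^sub>2 c" by (simp add: G_def)
    show "verts (with_proj G) = ?S\<^sub>1 \<union> ?S\<^sub>2 \<union> ?P\<^sub>1 \<union> ?P\<^sub>2" by (auto simp: G_def)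
  qed (use assms(1,2) in auto)
  show thesis
    using that[of G] SI_core[of s p] shape_eq c by simp
qed

theorem theorem8:
  fixes s p :: nat
  assumes "s \<ge> 2" and "p \<ge> 2"
  shows "num_nonisomorphic (SI_core_graphs s p) = num_partitions p * (num_partitions p + 1) div 2"
proof -
  have pos: "s > 0" "p > 0" using assms by auto
  let ?A = "{M :: nat multiset. 0 \<notin># M \<and> sum_mset M = p}"
  let ?G = "SI_core_graphs s p" and ?shape = "\<lambda>G :: nat pair_pre_digraph. shape (with_proj G)"
  \<comment> \<open>Isomorphism is the kernel of \<open>shape\<close>, so the classes are counted by
    its values.\<close>
  have "iso_on ?G = {(G, H). G \<in> ?G \<and> H \<in> ?G \<and> ?shape G = ?shape H}"
    unfolding iso_on_def SI_core_graphs_def using SI_core_iso_iff_shape_eq pos(1) by blast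
  then have "num_nonisomorphic ?G = card (?shape ` ?G)"
    unfolding num_nonisomorphic_def by (simp only: card_quotient_invariant)
  also have "?shape ` ?G = {{M, N} |M N. M \<in> ?A \<and> N \<in> ?A}"
  proof (intro equalityI subsetI)
    fix X assume "X \<in> ?shape ` ?G"
    then obtain G where "SI_core s p (with_proj G)" "X = ?shape G"
      by (auto simp: SI_core_graphs_def)
    then show "X \<in> {{M, N} |M N. M \<in> ?A \<and> N \<in> ?A}"
      using SI_core_shape[of s p "with_proj G"] pos(1) by blast
  next
    fix X assume "X \<in> {{M, N} |M N. M \<in> ?A \<and> N \<in> ?A}"
    then obtain M N where "X = {M, N}" "M \<in> ?A" "N \<in> ?A" by blast
    then obtain G where "SI_core s p (with_proj G)" "?shape G = X"
      using SI_core_realize[OF pos, of M N] by auto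
    then show "X \<in> ?shape ` ?G" by (auto simp: SI_core_graphs_def)
  qed
  also have "card \<dots> = num_partitions p * (num_partitions p + 1) div 2"
    using card_unordered_pairs[OF finite_partitions] by (simp add: num_partitions_def)
  finally show ?thesis .
qed

end
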